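(* Let $p\ge 5$ be a prime, $q=p^l$, $n\ge 2$ and $k\ge1$ integers, and $d=\gcd(k,q-1)$. Suppose $q>d^2$, $p\nmid k$, and $\gcd\big((q-1)/d,\,p-1\big)\ge 2$ (equivalently, the cyclic group $\mathbb F_p^\times\cap\{x^d\mid x\in\mathbb F_q\}$ has at least 2 elements). Then for $n>\max\left\{\frac{p^2-3p+9}{2},\frac{4\ln(k-1)}{\ln q}\right\}$ every matrix in $M_n(\mathbb F_q)$ is of the form $A^k+B^k$ with $A,B\in M_n(\mathbb F_q)$.
   Context: Convention: $\ln(0)=-\infty$ (relevant when $k=1$). *)

theory Defs
  imports
    "Jordan_Normal_Form.Matrix"
    "HOL-Computational_Algebra.Primes"
    "HOL-Library.Cardinality"
    "HOL-Library.Extended_Real"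
begin

text \<open>
  The library has \<open>ln 0 = 0\<close> on the reals; here the convention is \<open>ln 0 = -\<infinity>\<close>.
  It is only applied to arguments \<open>\<ge> 0\<close>.
\<close>

definition ln_ext :: "real \<Rightarrow> ereal" where
  "ln_ext x = (if x = 0 then -\<infinity> else ereal (ln x))"

end

theory Submission
  imports
    Defs
    "Jordan_Normal_Form.Determinant"
    "Jordan_Normal_Form.Column_Operations"
    "HOL-Analysis.Convex"
    "HOL-Algebra.Algebraic_Closure_Type"
begin

hide_const (open) Divisibility.prime up_ring.monom up_ring.coeff Polynomials.degree

text \<open>
  Nonscalar matrices: such an \<open>M\<close> is similar to a matrix with any prescribed diagonal of the same
  trace.  If the diagonal entries are \<open>a\<^sub>i + b\<^sub>i\<close> with nonzero \<open>k\<close>-th powers \<open>a\<^sub>i\<close>, \<open>b\<^sub>i\<close>, split the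
  matrix into a lower and an upper triangular one with diagonals \<open>a\<close> and \<open>b\<close>; since \<open>p\<close> does not
  divide \<open>k\<close>, each of them is a \<open>k\<close>-th power.  So every element of the field has to be a sum of exactly
  \<open>2n\<close> nonzero \<open>k\<close>-th powers.  With \<open>D\<close> the set of all \<open>k\<close>-th powers, \<open>|D|\<^sup>2 > q\<close> gives
  \<open>4D - 4D = F\<close>.  A \<open>k\<close>-th power \<open>z \<noteq> 1\<close> with \<open>z\<^sup>r = 1\<close>, \<open>r\<close> a prime divisor of \<open>p - 1\<close>, makes \<open>-1\<close> a
  sum of \<open>r - 1\<close> powers and \<open>0\<close> a sum of \<open>r\<close> powers, and \<open>0\<close> is also a sum of \<open>p\<close> ones; combining
  these pads the number of summands to \<open>2n\<close>.

  Scalar matrices: embed the field \<open>K\<close> with \<open>q\<^sup>n\<close> elements into the \<open>n \<times> n\<close> matrices and solve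
  \<open>x\<^sup>k + y\<^sup>k = \<lambda>\<close> in \<open>K\<close>.  That this is possible for \<open>q\<^sup>n > (k - 1)\<^sup>4\<close> is the classical Jacobi sum
  estimate; here it is derived without characters, from the exact second moment of the number of
  solutions of the twisted equations \<open>x\<^sup>k + c y\<^sup>k = \<lambda>\<close>.
\<close>

section \<open>Roots of triangular matrices\<close>

lemma upper_triangular_mult:
  fixes A B :: "'a::semiring_0 mat"
  assumes A: "A \<in> carrier_mat n n" "upper_triangular A"
    and B: "B \<in> carrier_mat n n" "upper_triangular B"
  shows "upper_triangular (A * B)"
    and "i < n \<Longrightarrow> (A * B) $$ (i, i) = A $$ (i, i) * B $$ (i, i)"
proof -
  have entry: "(A * B) $$ (i, j) = (\<Sum>l\<in>{i..<Suc j}. A $$ (i, l) * B $$ (l, j))"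
    if "i < n" "j < n" for i j
  proof -
    have "(A * B) $$ (i, j) = (\<Sum>l\<in>{0..<n}. A $$ (i, l) * B $$ (l, j))"
      using A B that by (simp add: scalar_prod_def)
    also have "\<dots> = (\<Sum>l\<in>{i..<Suc j}. A $$ (i, l) * B $$ (l, j))"
    proof (rule sum.mono_neutral_right)
      show "\<forall>l\<in>{0..<n} - {i..<Suc j}. A $$ (i, l) * B $$ (l, j) = 0"
      proof
        fix l assume "l \<in> {0..<n} - {i..<Suc j}"
        then have "l < i \<or> j < l" "l < n" by auto
        then show "A $$ (i, l) * B $$ (l, j) = 0"
          using A B that by (auto dest: upper_triangularD)
      qed
    qed (use that in auto)
    finally show ?thesis .
  qed
  show "upper_triangular (A * B)" 
  proof (rule upper_triangularI)
    fix i j assume "j < i" "i < dim_row (A * B)"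
    then show "(A * B) $$ (i, j) = 0" using A B entry[of i j] by (simp del: index_mult_mat(1))
  qed
  show "i < n \<Longrightarrow> (A * B) $$ (i, i) = A $$ (i, i) * B $$ (i, i)" by (simp add: entry)
qed

text \<open>
  For \<open>T = [[b, s], [0, T']]\<close> the upper right block of \<open>T ^ k\<close> is
  \<open>s * (b ^ (k - 1) + b ^ (k - 2) T' + \<dots> + T' ^ (k - 1))\<close>.
\<close>

fun hom_sum_mat :: "'a::comm_ring_1 \<Rightarrow> 'a mat \<Rightarrow> nat \<Rightarrow> 'a mat" where
  "hom_sum_mat b T 0 = 0\<^sub>m (dim_row T) (dim_row T)"
| "hom_sum_mat b T (Suc k) = b ^ k \<cdot>\<^sub>m 1\<^sub>m (dim_row T) + hom_sum_mat b T k * T"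

lemma hom_sum_mat_carrier [simp]:
  "T \<in> carrier_mat n n \<Longrightarrow> hom_sum_mat b T k \<in> carrier_mat n n"
  by (induction k) auto

lemma pow_four_block_row:
  fixes T :: "'a::comm_ring_1 mat"
  assumes T: "T \<in> carrier_mat n n" and s: "s \<in> carrier_mat 1 n"
  shows "four_block_mat (b \<cdot>\<^sub>m 1\<^sub>m 1) s (0\<^sub>m n 1) T ^\<^sub>m k =
    four_block_mat (b ^ k \<cdot>\<^sub>m 1\<^sub>m 1) (s * hom_sum_mat b T k) (0\<^sub>m n 1) (T ^\<^sub>m k)"
proof (induction k)
  case 0
  have "1\<^sub>m (Suc n) = four_block_mat (1\<^sub>m 1) (0\<^sub>m 1 n) (0\<^sub>m n 1) (1\<^sub>m n :: 'a mat)"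
    using four_block_one_mat[of 1 n] by simp
  moreover have "1 \<cdot>\<^sub>m 1\<^sub>m 1 = (1\<^sub>m 1 :: 'a mat)" by (intro eq_matI) auto
  ultimately show ?case using T s by simp
next
  case (Suc k)
  let ?\<Phi> = "hom_sum_mat b T k"
  have [simp]: "?\<Phi> \<in> carrier_mat n n" using T by simp
  have \<Phi>T: "?\<Phi> * T \<in> carrier_mat n n"
    by (rule mult_carrier_mat[OF _ T]) simp
  have Tk: "T ^\<^sub>m k \<in> carrier_mat n n" using T by simp
  have "(b ^ k \<cdot>\<^sub>m 1\<^sub>m 1) * s + s * ?\<Phi> * T = s * hom_sum_mat b T (Suc k)"
  proof -
    have "s * hom_sum_mat b T (Suc k) = s * (b ^ k \<cdot>\<^sub>m 1\<^sub>m n) + s * (?\<Phi> * T)"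
      using T s by (simp, subst mult_add_distrib_mat[OF s, of _ n]) (auto simp: \<Phi>T)
    also have "s * (b ^ k \<cdot>\<^sub>m 1\<^sub>m n) = b ^ k \<cdot>\<^sub>m s"
      using s by (subst mult_smult_distrib[OF s]) auto
    also have "\<dots> = (b ^ k \<cdot>\<^sub>m 1\<^sub>m 1) * s"
      using s by (subst mult_smult_assoc_mat[of _ 1 1 _ n]) auto
    also have "s * (?\<Phi> * T) = s * ?\<Phi> * T" using s T by (subst assoc_mult_mat[of _ 1 n _ n]) auto
    finally show ?thesis by simp
  qed
  moreover have "(b ^ k \<cdot>\<^sub>m 1\<^sub>m 1) * (b \<cdot>\<^sub>m 1\<^sub>m 1) + s * ?\<Phi> * 0\<^sub>m n 1 = b ^ Suc k \<cdot>\<^sub>m (1\<^sub>m 1 :: 'a mat)"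
    using s T by (intro eq_matI) (auto simp: scalar_prod_def)
  moreover have "0\<^sub>m n 1 * (b \<cdot>\<^sub>m 1\<^sub>m 1) + T ^\<^sub>m k * 0\<^sub>m n 1 = (0\<^sub>m n 1 :: 'a mat)"
    using right_mult_zero_mat[OF Tk, of 1] by simp
  moreover have "0\<^sub>m n 1 * s + T ^\<^sub>m k * T = T ^\<^sub>m Suc k"
    using s T left_add_zero_mat[OF mult_carrier_mat[OF Tk T]] by simp
  ultimately show ?case
    using T s Tk
    by (simp only: pow_mat.simps Suc.IH)
      (subst mult_four_block_mat[of _ 1 1 _ n _ n _ _ 1 _ n], auto)
qed

text \<open>The diagonal entries are the divided differences
  \<open>(b ^ k - t ^ k) / (b - t)\<close>, with the limit value \<open>k * b ^ (k - 1)\<close> at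
  \<open>t = b\<close>. They decide whether the matrix is invertible.\<close>

lemma upper_triangular_hom_sum_mat:
  fixes T :: "'a::comm_ring_1 mat"
  assumes T: "T \<in> carrier_mat n n" "upper_triangular T"
  shows "upper_triangular (hom_sum_mat b T k)"
    and "i < n \<Longrightarrow> (b - T $$ (i, i)) * hom_sum_mat b T k $$ (i, i) = b ^ k - T $$ (i, i) ^ k"
    and "i < n \<Longrightarrow> T $$ (i, i) = b \<Longrightarrow> hom_sum_mat b T k $$ (i, i) = of_nat k * b ^ (k - 1)"
proof -
  have ut: "upper_triangular (hom_sum_mat b T k)" for k
  proof (induction k)
    case 0
    then show ?case using T by (auto simp: upper_triangular_def)
  next
    case (Suc k)
    have "upper_triangular (hom_sum_mat b T k * T)"
      using upper_triangular_mult(1)[OF _ Suc T] T by simp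
    moreover have "dim_row (hom_sum_mat b T k) = n" using T hom_sum_mat_carrier by blast
    ultimately show ?case using T by (auto simp: upper_triangular_def simp del: index_mult_mat(1))
  qed
  then show "upper_triangular (hom_sum_mat b T k)" .
  have step: "hom_sum_mat b T (Suc k) $$ (i, i) = b ^ k + hom_sum_mat b T k $$ (i, i) * T $$ (i, i)"
    if "i < n" for i k
    using T that upper_triangular_mult(2)[OF hom_sum_mat_carrier[OF T(1)] ut T]
      carrier_matD[OF hom_sum_mat_carrier[OF T(1), of b k]] by (simp del: index_mult_mat(1))
  show "(b - T $$ (i, i)) * hom_sum_mat b T k $$ (i, i) = b ^ k - T $$ (i, i) ^ k" if "i < n"
  proof (induction k)
    case 0
    then show ?case using T that by simp
  next
    case (Suc k)
    have "(b - T $$ (i, i)) * hom_sum_mat b T (Suc k) $$ (i, i) =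
      (b - T $$ (i, i)) * b ^ k + ((b - T $$ (i, i)) * hom_sum_mat b T k $$ (i, i)) * T $$ (i, i)"
      unfolding step[OF that] by (simp add: algebra_simps)
    then show ?case unfolding Suc by (simp add: algebra_simps)
  qed
  show "hom_sum_mat b T k $$ (i, i) = of_nat k * b ^ (k - 1)" if "i < n" "T $$ (i, i) = b"
  proof (induction k)
    case 0
    then show ?case using T that by simp
  next
    case (Suc k)
    then show ?case unfolding step[OF that(1)] that(2) by (cases k) (auto simp: algebra_simps)
  qed
qed

lemma inverse_of_upper_triangular:
  fixes A :: "'a::field mat"
  assumes A: "A \<in> carrier_mat n n" "upper_triangular A" and diag: "\<And>i. i < n \<Longrightarrow> A $$ (i, i) \<noteq> 0"
  obtains B where "B \<in> carrier_mat n n" "A * B = 1\<^sub>m n" "B * A = 1\<^sub>m n"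
proof -
  have "det A \<noteq> 0"
    using A diag by (auto simp: upper_triangular_imp_det_eq_0_iff diag_mat_def)
  from det_non_zero_imp_unit[OF A(1) this, where b = "()"] show ?thesis
    using that by (auto simp: Units_def ring_mat_def)
qed

text \<open>The root is built by adding one row at a time. The new row \<open>s\<close> has to solve
  \<open>s * \<Phi> = r\<close>, so \<open>\<Phi>\<close> must be invertible. Taking all roots
  through one function \<open>\<rho>\<close> gives equal diagonal entries equal roots: where two
  roots agree, the diagonal of \<open>\<Phi>\<close> is \<open>k * b ^ (k - 1)\<close>; where they
  differ, so do their \<open>k\<close>-th powers.\<close>

lemma upper_triangular_root_aux:
  fixes U :: "'a::field mat" and \<rho> :: "'a \<Rightarrow> 'a"
  assumes "U \<in> carrier_mat n n" "upper_triangular U" and k: "of_nat k \<noteq> (0 :: 'a)"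
    and "\<And>i. i < n \<Longrightarrow> U $$ (i, i) \<noteq> 0 \<and> \<rho> (U $$ (i, i)) ^ k = U $$ (i, i)"
  shows "\<exists>T\<in>carrier_mat n n. upper_triangular T \<and>
    (\<forall>i<n. T $$ (i, i) = \<rho> (U $$ (i, i))) \<and> T ^\<^sub>m k = U"
  using assms(1,2,4)
proof (induction n arbitrary: U)
  case 0
  then show ?case by (intro bexI[of _ U]) (auto simp: upper_triangular_def)
next
  case (Suc n)
  note U = Suc.prems(1)
  obtain A1 r A3 U' where split: "split_block U 1 1 = (A1, r, A3, U')"
    by (metis prod_cases4)
  note sb = split_block[OF split, of n n]
  have carr: "A1 \<in> carrier_mat 1 1" "r \<in> carrier_mat 1 n" "A3 \<in> carrier_mat n 1" "U' \<in> carrier_mat n n"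
    and Ueq: "U = four_block_mat A1 r A3 U'" using sb U by auto
  have U'entry: "U' $$ (i, j) = U $$ (Suc i, Suc j)" if "i < n" "j < n" for i j
    using carr that by (simp add: Ueq)
  define a where "a = U $$ (0, 0)"
  define b where "b = \<rho> a"
  have a: "a \<noteq> 0" "b ^ k = a" using Suc.prems(3)[of 0] by (auto simp: a_def b_def)
  have b: "b \<noteq> 0" using a k by (cases k) auto
  have A1: "A1 = a \<cdot>\<^sub>m 1\<^sub>m 1" using carr by (intro eq_matI) (auto simp: a_def Ueq)
  have A3: "A3 = 0\<^sub>m n 1"
  proof (intro eq_matI)
    fix i j assume "i < dim_row (0\<^sub>m n 1 :: 'a mat)" "j < dim_col (0\<^sub>m n 1 :: 'a mat)"
    then have ij: "i < n" "j = 0" by auto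
    have "A3 $$ (i, 0) = U $$ (Suc i, 0)" using carr ij by (simp add: Ueq)
    also have "\<dots> = 0" using Suc.prems(1,2) ij by (intro upper_triangularD) auto
    finally show "A3 $$ (i, j) = 0\<^sub>m n 1 $$ (i, j)" using ij by simp
  qed (use carr in auto)
  have "upper_triangular U'"

  proof (rule upper_triangularI)
    fix i j assume "j < i" "i < dim_row U'"
    then show "U' $$ (i, j) = 0"
      using Suc.prems(1,2) carr upper_triangularD[of U "Suc j" "Suc i"] by (simp add: U'entry)
  qed
  then obtain T where T: "T \<in> carrier_mat n n" "upper_triangular T" "T ^\<^sub>m k = U'"
    and Xd: "\<And>i. i < n \<Longrightarrow> T $$ (i, i) = \<rho> (U $$ (Suc i, Suc i))"
    using Suc.IH[OF carr(4)] Suc.prems(3) by (auto simp: U'entry)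
  define \<Phi> where "\<Phi> = hom_sum_mat b T k"
  have \<Phi>: "\<Phi> \<in> carrier_mat n n" "upper_triangular \<Phi>"
    using T upper_triangular_hom_sum_mat(1)[OF T(1,2)] by (auto simp: \<Phi>_def)
  have "\<Phi> $$ (i, i) \<noteq> 0" if "i < n" for i
  proof (cases "T $$ (i, i) = b")
    case True
    then show ?thesis using upper_triangular_hom_sum_mat(3)[OF T(1,2) that] k b by (simp add: \<Phi>_def)
  next
    case False
    have "b ^ k \<noteq> T $$ (i, i) ^ k"
    proof
      assume eq: "b ^ k = T $$ (i, i) ^ k"
      have "T $$ (i, i) ^ k = U $$ (Suc i, Suc i)" using Suc.prems(3)[of "Suc i"] that by (simp add: Xd)
      then have "a = U $$ (Suc i, Suc i)" using eq a by simp
      then show False using False Xd[OF that] by (simp add: b_def)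
    qed
    then show ?thesis using upper_triangular_hom_sum_mat(2)[OF T(1,2) that, of b k] by (auto simp: \<Phi>_def)
  qed
  then obtain \<Psi> where \<Psi>: "\<Psi> \<in> carrier_mat n n" "\<Psi> * \<Phi> = 1\<^sub>m n"
    using inverse_of_upper_triangular[OF \<Phi>] by metis
  define s where "s = r * \<Psi>"
  have s: "s \<in> carrier_mat 1 n" "s * \<Phi> = r"
    using carr \<Psi> \<Phi> by (auto simp: s_def assoc_mult_mat[of _ 1 n _ n _ n])
  define Y where "Y = four_block_mat (b \<cdot>\<^sub>m 1\<^sub>m 1) s (0\<^sub>m n 1) T"
  have "Y ^\<^sub>m k = U"
    unfolding Y_def pow_four_block_row[OF T(1) s(1)] using s a T by (simp add: \<Phi>_def Ueq A1 A3)
  moreover have "Y \<in> carrier_mat (Suc n) (Suc n)"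
    using four_block_carrier_mat[of "b \<cdot>\<^sub>m 1\<^sub>m 1" 1 1 T n n] T by (simp add: Y_def)
  moreover have "upper_triangular Y"

  proof (rule upper_triangularI)
    fix i j assume "j < i" "i < dim_row Y"
    then show "Y $$ (i, j) = 0"
      using T upper_triangularD[OF T(2), of "j - 1" "i - 1"] by (auto simp: Y_def)
  qed
  moreover have "Y $$ (i, i) = \<rho> (U $$ (i, i))" if "i < Suc n" for i
    using that T Xd[of "i - 1"] by (cases i) (auto simp: Y_def b_def a_def)
  ultimately show ?case by blast
qed

lemma upper_triangular_root:
  fixes U :: "'a::field mat"
  assumes "U \<in> carrier_mat n n" "upper_triangular U" "of_nat k \<noteq> (0 :: 'a)"
    and diag: "\<And>i. i < n \<Longrightarrow> \<exists>x. x \<noteq> 0 \<and> U $$ (i, i) = x ^ k"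
  shows "\<exists>T\<in>carrier_mat n n. T ^\<^sub>m k = U"
proof -
  define \<rho> where "\<rho> a = (SOME x. x ^ k = a)" for a :: 'a
  have "U $$ (i, i) \<noteq> 0 \<and> \<rho> (U $$ (i, i)) ^ k = U $$ (i, i)" if "i < n" for i
    using diag[OF that] someI_ex[of "\<lambda>x. x ^ k = U $$ (i, i)"] by (metis \<rho>_def power_not_zero)
  then show ?thesis using upper_triangular_root_aux[OF assms(1-3)] by blast
qed

section \<open>Matrices with prescribed diagonal\<close>

lemma sum_diag_mult_commute:
  fixes A B :: "'a::comm_ring_1 mat"
  assumes "A \<in> carrier_mat n n" "B \<in> carrier_mat n n"
  shows "(\<Sum>i<n. (A * B) $$ (i, i)) = (\<Sum>i<n. (B * A) $$ (i, i))"
proof -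
  have "(\<Sum>i<n. (A * B) $$ (i, i)) = (\<Sum>i<n. \<Sum>j<n. A $$ (i, j) * B $$ (j, i))"
    using assms by (simp add: scalar_prod_def atLeast0LessThan)
  also have "\<dots> = (\<Sum>j<n. \<Sum>i<n. B $$ (j, i) * A $$ (i, j))"
    by (subst sum.swap) (simp add: mult.commute)
  also have "\<dots> = (\<Sum>i<n. (B * A) $$ (i, i))"
    using assms by (simp add: scalar_prod_def atLeast0LessThan)
  finally show ?thesis .
qed

lemma similar_mat_sum_diag:
  fixes A B :: "'a::comm_ring_1 mat"
  assumes A: "A \<in> carrier_mat n n" and sim: "similar_mat A B"
  shows "(\<Sum>i<n. A $$ (i, i)) = (\<Sum>i<n. B $$ (i, i))"
proof -
  obtain P Q where "similar_mat_wit A B P Q" using sim unfolding similar_mat_def by blast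
  note w = similar_mat_witD2[OF A this]
  have "Q * (P * B) = B" using w by (simp add: assoc_mult_mat[of Q n n P n B n, symmetric])
  then show ?thesis
    using sum_diag_mult_commute[of "P * B" n Q] w by simp
qed

lemma similar_mat_carrier:
  assumes "A \<in> carrier_mat n n" "similar_mat A B"
  shows "B \<in> carrier_mat n n"
  using assms unfolding similar_mat_def by (blast dest: similar_mat_witD2)

lemma similar_mat_transpose:
  fixes A B :: "'a::comm_ring_1 mat"
  assumes A: "A \<in> carrier_mat n n" and sim: "similar_mat A B"
  shows "similar_mat (transpose_mat A) (transpose_mat B)"
proof -
  obtain P Q where "similar_mat_wit A B P Q" using sim unfolding similar_mat_def by blast
  note w = similar_mat_witD2[OF A this]
  have "transpose_mat A = transpose_mat Q * transpose_mat B * transpose_mat P"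
    unfolding w(3) using w(5-)
    by (simp add: transpose_mult[of _ n n _ n] assoc_mult_mat[of _ n n _ n _ n])
  moreover have "transpose_mat Q * transpose_mat P = 1\<^sub>m n" "transpose_mat P * transpose_mat Q = 1\<^sub>m n"
    using w by (simp_all add: transpose_mult[of _ n n _ n, symmetric])
  ultimately have "similar_mat_wit (transpose_mat A) (transpose_mat B) (transpose_mat Q) (transpose_mat P)"
    using w by (intro similar_mat_witI[of _ _ n]) auto
  then show ?thesis unfolding similar_mat_def by blast
qed

text \<open>Conjugation by the block diagonal matrix of \<open>I\<close> and \<open>P\<close> keeps
  the corner \<open>A\<close>, so a diagonal entry that is already adjusted survives the work on
  \<open>D\<close>.\<close>

lemma similar_mat_lower_right_block:
  fixes A D E :: "'a::comm_ring_1 mat"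
  assumes c: "A \<in> carrier_mat n n" "B \<in> carrier_mat n m" "C \<in> carrier_mat m n" "D \<in> carrier_mat m m"
    and sim: "similar_mat D E"
  obtains B' C' where "B' \<in> carrier_mat n m" "C' \<in> carrier_mat m n"
    "similar_mat (four_block_mat A B C D) (four_block_mat A B' C' E)"
proof -
  obtain P Q where wit: "similar_mat_wit D E P Q" using sim unfolding similar_mat_def by blast
  note w = similar_mat_witD2[OF c(4) wit]
  have "similar_mat_wit (four_block_mat A B C D) (four_block_mat A (B * P) (Q * C) E)
    (four_block_mat (1\<^sub>m n) (0\<^sub>m n m) (0\<^sub>m m n) P) (four_block_mat (1\<^sub>m n) (0\<^sub>m n m) (0\<^sub>m m n) Q)"
  proof (rule similar_mat_wit_four_block[OF similar_mat_wit_refl[OF c(1)] wit])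
    show "B = 1\<^sub>m n * (B * P) * Q"
      using c w left_mult_one_mat[of "B * P" n m] by (simp add: assoc_mult_mat[of B n m P m Q m])
    show "C = P * (Q * C) * 1\<^sub>m n"
      using c w right_mult_one_mat[of "P * (Q * C)" m n] by (simp add: assoc_mult_mat[of P m m Q m C n, symmetric])
  qed (use c w in auto)
  then have "similar_mat (four_block_mat A B C D) (four_block_mat A (B * P) (Q * C) E)"
    unfolding similar_mat_def by blast
  moreover have "B * P \<in> carrier_mat n m" "Q * C \<in> carrier_mat m n" using c w by auto
  ultimately show ?thesis using that by blast
qed

text \<open>
  One conjugation by \<open>I + t E\<^sub>0\<^sub>1 + s E\<^sub>0\<^sub>2\<close> moves the corner entry to its target (choice of \<open>t\<close>)
  and keeps the entry \<open>(1, 2)\<close> nonzero (choice of \<open>s\<close>); the transpose of the remaining block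
  then satisfies the induction hypothesis.
\<close>

lemma similar_mat_prescribed_diag_aux:
  fixes M :: "'a::field mat"
  assumes "M \<in> carrier_mat n n" "n \<ge> 1" "n \<ge> 2 \<Longrightarrow> M $$ (1, 0) \<noteq> 0"
    and "(\<Sum>i<n. M $$ (i, i)) = (\<Sum>i<n. f i)"
  shows "\<exists>N. similar_mat M N \<and> (\<forall>i<n. N $$ (i, i) = f i)"
  using assms
proof (induction n arbitrary: M f)
  case 0
  then show ?case by simp
next
  case (Suc n)
  note M = Suc.prems(1)
  show ?case
  proof (cases "n = 0")
    case True
    then show ?thesis using Suc.prems similar_mat_refl[OF M] by auto
  next
    case False
    define c where "c = M $$ (1, 0)"
    have c: "c \<noteq> 0" using Suc.prems(3) False by (simp add: c_def)
    \<comment> \<open>Adding column 0 to column 2 turns a vanishing entry \<open>(1, 2)\<close> into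
      \<open>c\<close>; the matching subtraction of row 2 changes only row 0.\<close>
    define M1 where "M1 = (if n \<ge> 2 then add_col_sub_row (if M $$ (1, 2) = 0 then 1 else 0) 0 2 M else M)"
    have M1: "M1 \<in> carrier_mat (Suc n) (Suc n)" using M by (auto simp: M1_def)
    have sim1: "similar_mat M M1"
      using add_col_sub_row_similar[OF M, of 0 2] similar_mat_refl[OF M]
      by (auto simp: M1_def intro: similar_mat_sym)
    have M1_10: "M1 $$ (1, 0) = c" using M False by (auto simp: M1_def c_def)
    have M1_12: "M1 $$ (1, 2) \<noteq> 0" if "n \<ge> 2" using M that c by (auto simp: M1_def c_def)
    \<comment> \<open>Row 0 loses this multiple of row 1, whose entry in column 0 is
      \<open>c\<close>, so the corner becomes \<open>f 0\<close>. The entry \<open>(1, 2)\<close> is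
      not touched.\<close>
    define M2 where "M2 = add_col_sub_row ((M1 $$ (0, 0) - f 0) / c) 0 1 M1"
    have M2: "M2 \<in> carrier_mat (Suc n) (Suc n)" using M1 by (auto simp: M2_def)
    have sim2: "similar_mat M1 M2"
      unfolding M2_def using M1 False by (intro similar_mat_sym[OF add_col_sub_row_similar[OF M1]]) auto
    have M2_00: "M2 $$ (0, 0) = f 0" using M1 False M1_10 c by (auto simp: M2_def)
    have M2_12: "M2 $$ (1, 2) \<noteq> 0" if "n \<ge> 2" using M1 that M1_12 by (auto simp: M2_def)
    have simM: "similar_mat M M2" using similar_mat_trans[OF sim1 sim2] .
    obtain A B C D where split: "split_block M2 1 1 = (A, B, C, D)"
      by (metis prod_cases4)
    have carr: "A \<in> carrier_mat 1 1" "B \<in> carrier_mat 1 n" "C \<in> carrier_mat n 1" "D \<in> carrier_mat n n"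
      and eq: "M2 = four_block_mat A B C D" using split_block[OF split, of n n] M2 by auto
    have D_entry: "D $$ (i, j) = M2 $$ (Suc i, Suc j)" if "i < n" "j < n" for i j
      using carr that by (simp add: eq)
    have "(\<Sum>i<Suc n. M2 $$ (i, i)) = (\<Sum>i<Suc n. f i)"
      using similar_mat_sum_diag[OF M simM] Suc.prems(4) by simp
    then have "(\<Sum>i<n. M2 $$ (Suc i, Suc i)) = (\<Sum>i<n. f (Suc i))"
      by (simp add: sum.lessThan_Suc_shift M2_00 del: sum.lessThan_Suc)
    then have tr: "(\<Sum>i<n. transpose_mat D $$ (i, i)) = (\<Sum>i<n. f (Suc i))"
      using carr by (simp add: D_entry)
    have "\<exists>N. similar_mat (transpose_mat D) N \<and> (\<forall>i<n. N $$ (i, i) = f (Suc i))"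
    proof (rule Suc.IH[OF _ _ _ tr])
      show "transpose_mat D $$ (1, 0) \<noteq> 0" if "n \<ge> 2"
        using carr that M2_12 by (simp add: D_entry numeral_2_eq_2)
    qed (use carr False in auto)
    then obtain N where N: "similar_mat (transpose_mat D) N" "\<And>i. i < n \<Longrightarrow> N $$ (i, i) = f (Suc i)"
      by blast
    have Nc: "N \<in> carrier_mat n n" using similar_mat_carrier[OF _ N(1)] carr by simp
    have "similar_mat D (transpose_mat N)"
      using similar_mat_transpose[OF _ N(1), of n] carr by simp
    then obtain B' C' where "similar_mat M2 (four_block_mat A B' C' (transpose_mat N))"
      using similar_mat_lower_right_block[OF carr] eq by metis
    then have "similar_mat M (four_block_mat A B' C' (transpose_mat N))"
      using similar_mat_trans[OF simM] by blast
    moreover have "four_block_mat A B' C' (transpose_mat N) $$ (i, i) = f i" if "i < Suc n" for i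
    proof (cases i)
      case 0
      have "A $$ (0, 0) = M2 $$ (0, 0)" using carr by (simp add: eq)
      then show ?thesis using 0 carr Nc M2_00 by simp
    next
      case (Suc j)
      then show ?thesis using that carr Nc N(2)[of j] by simp
    qed
    ultimately show ?thesis by blast
  qed
qed

text \<open>Either some off-diagonal entry is nonzero and two swaps carry it to position
  \<open>(1, 0)\<close>, or the matrix is diagonal with two distinct entries, and conjugation by an
  elementary matrix puts their difference off the diagonal.\<close>

lemma nonscalar_similar_mat_subdiag:
  fixes M :: "'a::field mat"
  assumes M: "M \<in> carrier_mat n n" and nonscalar: "\<And>c. M \<noteq> c \<cdot>\<^sub>m 1\<^sub>m n"
  obtains N where "similar_mat M N" "N $$ (1, 0) \<noteq> 0" "n \<ge> 2"
proof -
  have offdiag: "\<exists>N. similar_mat M N \<and> N $$ (1, 0) \<noteq> 0 \<and> n \<ge> 2"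
    if L: "similar_mat M L" "L \<in> carrier_mat n n" and ij: "i < n" "j < n" "i \<noteq> j" "L $$ (i, j) \<noteq> 0" for L i j
  proof -
    define L1 where "L1 = swap_cols_rows 0 j L"
    have L1: "L1 \<in> carrier_mat n n" "similar_mat M L1"
      using L ij similar_mat_sym[OF swap_cols_rows_similar[OF L(2), of 0 j]]
      by (auto simp: L1_def intro!: similar_mat_trans[OF L(1)])
    \<comment> \<open>Swapping 0 and \<open>j\<close> brings column \<open>j\<close> to the front; a
      row 0 has thereby moved to position \<open>j\<close>.\<close>
    define i' where "i' = (if i = 0 then j else i)"
    have i': "0 < i'" "i' < n" using ij by (auto simp: i'_def)
    have e: "L1 $$ (i', 0) \<noteq> 0" using L ij by (auto simp: L1_def i'_def)
    define L2 where "L2 = swap_cols_rows 1 i' L1"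
    have "similar_mat M L2"
      using L1 i' similar_mat_sym[OF swap_cols_rows_similar[OF L1(1), of 1 i']]
      by (auto simp: L2_def intro!: similar_mat_trans[OF L1(2)])
    moreover have "L2 $$ (1, 0) \<noteq> 0" using e L1 i' by (auto simp: L2_def)
    ultimately show ?thesis using i' by auto
  qed
  show ?thesis
  proof (cases "\<exists>i j. i < n \<and> j < n \<and> i \<noteq> j \<and> M $$ (i, j) \<noteq> 0")
    case True
    then show ?thesis using offdiag[OF similar_mat_refl[OF M] M] that by blast
  next
    case False
    have "\<exists>i<n. M $$ (i, i) \<noteq> M $$ (0, 0)"
    proof (rule ccontr)
      assume "\<not> ?thesis"
      then have diag: "M $$ (i, i) = M $$ (0, 0)" if "i < n" for i using that by blast
      define c where "c = M $$ (0, 0)"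
      have "M $$ (i, j) = (c \<cdot>\<^sub>m 1\<^sub>m n) $$ (i, j)" if "i < n" "j < n" for i j
        using False that diag[of i] by (cases "i = j") (auto simp: c_def)
      then have "M = c \<cdot>\<^sub>m 1\<^sub>m n" using M by (intro eq_matI) auto
      then show False using nonscalar by blast
    qed
    then obtain i where i: "i < n" "M $$ (i, i) \<noteq> M $$ (0, 0)" "i \<noteq> 0" by auto
    let ?L = "add_col_sub_row 1 0 i M"
    have "similar_mat M ?L"
      using i M by (intro similar_mat_sym[OF add_col_sub_row_similar[OF M]]) auto
    moreover have "M $$ (0, i) = 0" "M $$ (i, 0) = 0" using i False by auto
    then have "?L $$ (0, i) \<noteq> 0" using i M by auto
    moreover have "?L \<in> carrier_mat n n" using M by simp
    ultimately show ?thesis using offdiag[of ?L 0 i] that i by auto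
  qed
qed

lemma similar_mat_prescribed_diag:
  fixes M :: "'a::field mat"
  assumes M: "M \<in> carrier_mat n n" and nonscalar: "\<And>c. M \<noteq> c \<cdot>\<^sub>m 1\<^sub>m n"
    and tr: "(\<Sum>i<n. M $$ (i, i)) = (\<Sum>i<n. f i)"
  obtains N where "similar_mat M N" "\<And>i. i < n \<Longrightarrow> N $$ (i, i) = f i"
proof -
  obtain L where L: "similar_mat M L" "L $$ (1, 0) \<noteq> 0" "n \<ge> 2"
    using nonscalar_similar_mat_subdiag[OF M nonscalar] by metis
  have "\<exists>N. similar_mat L N \<and> (\<forall>i<n. N $$ (i, i) = f i)"
    using similar_mat_prescribed_diag_aux[OF similar_mat_carrier[OF M L(1)]] L
      similar_mat_sum_diag[OF M L(1)] tr by simp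
  then show ?thesis using similar_mat_trans[OF L(1)] that by metis
qed

section \<open>Splitting a nonscalar matrix into two triangular powers\<close>

lemma transpose_pow_mat:
  fixes A :: "'a::comm_semiring_1 mat"
  assumes A: "A \<in> carrier_mat n n"
  shows "transpose_mat (A ^\<^sub>m k) = transpose_mat A ^\<^sub>m k"
proof (induction k)
  case 0
  then show ?case using A by simp
next
  case (Suc k)
  have "transpose_mat (A ^\<^sub>m Suc k) = transpose_mat A * transpose_mat A ^\<^sub>m k"
    using A Suc by (simp add: transpose_mult[of _ n n _ n])
  also have "\<dots> = transpose_mat A ^\<^sub>m k * transpose_mat A"
  proof (induction k)
    case 0
    then show ?case using A by simp
  next
    case (Suc k)
    have "transpose_mat A * (transpose_mat A ^\<^sub>m k * transpose_mat A) =
      (transpose_mat A * transpose_mat A ^\<^sub>m k) * transpose_mat A"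
      using A by (intro assoc_mult_mat[symmetric, of _ n n _ n _ n]) auto
    then show ?case using Suc by simp
  qed
  finally show ?case by simp
qed

lemma nonscalar_mat_sum_of_two_powers:
  fixes M :: "'a::field mat"
  assumes M: "M \<in> carrier_mat n n" and nonscalar: "\<And>c. M \<noteq> c \<cdot>\<^sub>m 1\<^sub>m n"
    and k: "of_nat k \<noteq> (0 :: 'a)"
    and a: "\<And>i. i < n \<Longrightarrow> a i \<noteq> 0" and b: "\<And>i. i < n \<Longrightarrow> b i \<noteq> 0"
    and tr: "(\<Sum>i<n. M $$ (i, i)) = (\<Sum>i<n. a i ^ k + b i ^ k)"
  shows "\<exists>A\<in>carrier_mat n n. \<exists>B\<in>carrier_mat n n. M = A ^\<^sub>m k + B ^\<^sub>m k"
proof -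
  obtain N where sim: "similar_mat M N" and diag: "\<And>i. i < n \<Longrightarrow> N $$ (i, i) = a i ^ k + b i ^ k"
    using similar_mat_prescribed_diag[OF M nonscalar tr] by metis
  have N: "N \<in> carrier_mat n n" using similar_mat_carrier[OF M sim] .
  define U where "U = mat n n (\<lambda>(i, j). if i = j then a i ^ k else if i < j then N $$ (i, j) else 0)"
  \<comment> \<open>The strictly lower part of \<open>N\<close> enters transposed, so that the root
    lemma for upper triangular matrices serves both summands.\<close>
  define L where "L = mat n n (\<lambda>(i, j). if i = j then b i ^ k else if i < j then N $$ (j, i) else 0)"
  have "upper_triangular U" "upper_triangular L"
    by (auto simp: U_def L_def upper_triangular_def)
  moreover have U: "U \<in> carrier_mat n n" and L: "L \<in> carrier_mat n n" by (auto simp: U_def L_def)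
  ultimately obtain T Y where T: "T \<in> carrier_mat n n" "T ^\<^sub>m k = U" and Y: "Y \<in> carrier_mat n n" "Y ^\<^sub>m k = L"
  proof -
    assume ut: "upper_triangular U" "upper_triangular L"
    have "\<exists>x. x \<noteq> 0 \<and> U $$ (i, i) = x ^ k" "\<exists>x. x \<noteq> 0 \<and> L $$ (i, i) = x ^ k" if "i < n" for i
      using a[OF that] b[OF that] that by (auto simp: U_def L_def)
    then show thesis
      using upper_triangular_root[OF U ut(1) k] upper_triangular_root[OF L ut(2) k] that by blast
  qed
  have "N = U + transpose_mat L"
    using N diag by (intro eq_matI) (auto simp: U_def L_def)
  then have Neq: "N = T ^\<^sub>m k + transpose_mat Y ^\<^sub>m k" using T Y transpose_pow_mat[OF Y(1), of k] by simp
  obtain P Q where wit: "similar_mat_wit M N P Q" using sim unfolding similar_mat_def by blast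
  note w = similar_mat_witD2[OF M wit]
  have conj: "P * Z ^\<^sub>m k * Q = (P * Z * Q) ^\<^sub>m k" if Z: "Z \<in> carrier_mat n n" for Z
  proof -
    have "similar_mat_wit (P * Z * Q) Z P Q"
      using w Z by (intro similar_mat_witI[of _ _ n]) auto
    then show ?thesis using similar_mat_wit_pow_id by metis
  qed
  have "M = P * (T ^\<^sub>m k + transpose_mat Y ^\<^sub>m k) * Q" using w(3) Neq by simp
  also have "\<dots> = P * T ^\<^sub>m k * Q + P * transpose_mat Y ^\<^sub>m k * Q"
    using w T(1) Y(1) pow_carrier_mat[OF T(1), of k] pow_carrier_mat[of "transpose_mat Y" n k]
    by (simp add: mult_add_distrib_mat[of _ n n _ n] add_mult_distrib_mat[of _ n n _ _ n])
  also have "\<dots> = (P * T * Q) ^\<^sub>m k + (P * transpose_mat Y * Q) ^\<^sub>m k"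
    using conj[OF T(1)] conj[of "transpose_mat Y"] Y(1) by simp
  finally have "M = (P * T * Q) ^\<^sub>m k + (P * transpose_mat Y * Q) ^\<^sub>m k" .
  moreover have "P * T * Q \<in> carrier_mat n n" "P * transpose_mat Y * Q \<in> carrier_mat n n"
    using w T(1) Y(1) by auto
  ultimately show ?thesis by blast
qed

section \<open>Sums of two powers in a finite field\<close>

text \<open>A set inside an ambient field rather than a type: this covers a whole finite field as
  well as subfields of an algebraic closure whose size depends on \<open>n\<close>.\<close>

locale finite_subfield =
  fixes K :: "'b::field set"
  assumes finite_K [simp]: "finite K"
    and zero_mem [simp]: "0 \<in> K" and one_mem [simp]: "1 \<in> K"
    and add_mem [simp]: "x \<in> K \<Longrightarrow> y \<in> K \<Longrightarrow> x + y \<in> K"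
    and uminus_mem [simp]: "x \<in> K \<Longrightarrow> - x \<in> K"
    and mult_mem [simp]: "x \<in> K \<Longrightarrow> y \<in> K \<Longrightarrow> x * y \<in> K"
    and inverse_mem [simp]: "x \<in> K \<Longrightarrow> inverse x \<in> K"
begin

lemma diff_mem [simp]: "x \<in> K \<Longrightarrow> y \<in> K \<Longrightarrow> x - y \<in> K"
  using add_mem[of x "- y"] by simp

lemma divide_mem [simp]: "x \<in> K \<Longrightarrow> y \<in> K \<Longrightarrow> x / y \<in> K"
  by (simp add: field_class.field_divide_inverse)

lemma power_mem [simp]: "x \<in> K \<Longrightarrow> x ^ n \<in> K"
  by (induction n) auto

lemma sum_translate: "a \<in> K \<Longrightarrow> (\<Sum>x\<in>K. \<phi> (x - a)) = (\<Sum>x\<in>K. \<phi> x)"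
  by (rule sum.reindex_bij_witness[of _ "\<lambda>x. x + a" "\<lambda>x. x - a"]) auto

lemma sum_reflect: "a \<in> K \<Longrightarrow> (\<Sum>x\<in>K. \<phi> (a - x)) = (\<Sum>x\<in>K. \<phi> x)"
  by (rule sum.reindex_bij_witness[of _ "\<lambda>x. a - x" "\<lambda>x. a - x"]) auto

lemma sum_scale: "c \<in> K - {0} \<Longrightarrow> (\<Sum>x\<in>K. \<phi> (c * x)) = (\<Sum>x\<in>K. \<phi> x)"
  by (rule sum.reindex_bij_witness[of _ "\<lambda>x. x / c" "\<lambda>x. c * x"]) auto

lemma sum_units_scale: "t \<in> K - {0} \<Longrightarrow> (\<Sum>c\<in>K - {0}. \<phi> (c * t)) = (\<Sum>c\<in>K - {0}. \<phi> c)"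
  by (rule sum.reindex_bij_witness[of _ "\<lambda>x. x / t" "\<lambda>x. x * t"]) auto

text \<open>
  The weight \<open>g + 1\<close> counts the \<open>d\<close>-th roots when \<open>H\<close> consists of the \<open>d\<close>-th powers, so
  \<open>conv 1 \<lambda>\<close> is the deviation of the number of solutions of \<open>x ^ d + y ^ d = \<lambda>\<close> from its expected
  value \<open>card K\<close>.  Its second moment over all twists \<open>c\<close> can be computed exactly.
\<close>

context
  fixes g :: "'b \<Rightarrow> real"
  assumes g0: "g 0 = 0" and sum_g: "(\<Sum>x\<in>K. g x) = 0"
begin

definition conv :: "'b \<Rightarrow> 'b \<Rightarrow> real" where
  "conv c y = (\<Sum>x\<in>K. g (c * x) * g (y - x))"

definition autocorr :: "'b \<Rightarrow> real" where
  "autocorr t = (\<Sum>x\<in>K. g x * g (x + t))"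

lemma sum_conv_right: "(\<Sum>y\<in>K. conv c y) = 0"
proof -
  have "(\<Sum>y\<in>K. conv c y) = (\<Sum>x\<in>K. g (c * x) * (\<Sum>y\<in>K. g (y - x)))"
    unfolding conv_def by (subst sum.swap) (simp add: sum_distrib_left)
  also have "\<dots> = 0"
    by (rule sum.neutral) (simp add: sum_translate sum_g)
  finally show ?thesis .
qed

lemma sum_units_g: "(\<Sum>c\<in>K - {0}. g c) = 0"
  using sum_g g0 by (simp add: sum.remove[of K 0])

lemma sum_conv_left: "y \<in> K \<Longrightarrow> (\<Sum>c\<in>K - {0}. conv c y) = 0"
proof -
  assume y: "y \<in> K"
  have "(\<Sum>c\<in>K - {0}. conv c y) = (\<Sum>x\<in>K. (\<Sum>c\<in>K - {0}. g (c * x)) * g (y - x))"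
    unfolding conv_def by (subst sum.swap) (simp add: sum_distrib_right)
  also have "\<dots> = 0"
  proof (rule sum.neutral, rule ballI)
    fix x assume "x \<in> K"
    then have "(\<Sum>c\<in>K - {0}. g (c * x)) = 0"
      using g0 sum_units_scale[of x g] sum_units_g by (cases "x = 0") auto
    then show "(\<Sum>c\<in>K - {0}. g (c * x)) * g (y - x) = 0" by simp
  qed
  finally show ?thesis .
qed

lemma sum_autocorr: "(\<Sum>t\<in>K. autocorr t) = 0"
proof -
  have "(\<Sum>t\<in>K. autocorr t) = (\<Sum>x\<in>K. g x * (\<Sum>t\<in>K. g (t - (- x))))"
    unfolding autocorr_def by (subst sum.swap) (simp add: sum_distrib_left add.commute)
  also have "\<dots> = 0"
    by (rule sum.neutral) (metis sum_translate sum_g mult_zero_right uminus_mem)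
  finally show ?thesis .
qed

text \<open>Expanding the square gives a double sum over \<open>x\<close> and
  \<open>x' = x - t\<close>. For a fixed difference \<open>t\<close>, summing over \<open>y\<close>
  produces \<open>autocorr t\<close> and summing over \<open>x\<close> produces
  \<open>autocorr (c * t)\<close>.\<close>

lemma sum_conv_square:
  assumes c: "c \<in> K - {0}"
  shows "(\<Sum>y\<in>K. (conv c y)\<^sup>2) = (\<Sum>t\<in>K. autocorr t * autocorr (c * t))"
proof -
  have corr: "(\<Sum>y\<in>K. g (y - x) * g (y - (x - t))) = autocorr t" if "x \<in> K" "t \<in> K" for x t
    using sum_translate[OF that(1), of "\<lambda>z. g z * g (z + t)"] by (simp add: autocorr_def algebra_simps)
  have "(\<Sum>y\<in>K. (conv c y)\<^sup>2) =
    (\<Sum>y\<in>K. \<Sum>x\<in>K. \<Sum>x'\<in>K. g (c * x) * g (c * x') * (g (y - x) * g (y - x')))"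
    unfolding conv_def power2_eq_square by (simp add: sum_product mult_ac)
  also have "\<dots> = (\<Sum>y\<in>K. \<Sum>x\<in>K. \<Sum>t\<in>K. g (c * x) * g (c * (x - t)) * (g (y - x) * g (y - (x - t))))"
    by (intro sum.cong refl sum_reflect[symmetric])
  also have "\<dots> = (\<Sum>x\<in>K. \<Sum>t\<in>K. \<Sum>y\<in>K. g (c * x) * g (c * (x - t)) * (g (y - x) * g (y - (x - t))))"
    by (subst sum.swap) (intro sum.cong refl sum.swap)
  also have "\<dots> = (\<Sum>x\<in>K. \<Sum>t\<in>K. g (c * x) * g (c * (x - t)) * autocorr t)"
    by (intro sum.cong refl) (simp add: sum_distrib_left[symmetric] corr)
  also have "\<dots> = (\<Sum>t\<in>K. autocorr t * (\<Sum>x\<in>K. g (c * x) * g (c * x - c * t)))"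
    by (subst sum.swap) (simp add: sum_distrib_left algebra_simps)
  also have "\<dots> = (\<Sum>t\<in>K. autocorr t * autocorr (c * t))"
  proof (intro sum.cong refl)
    fix t assume t: "t \<in> K"
    have "(\<Sum>x\<in>K. g (c * x) * g (c * x - c * t)) = (\<Sum>x\<in>K. g x * g (x - c * t))"
      using sum_scale[OF c, of "\<lambda>x. g x * g (x - c * t)"] .
    also have "\<dots> = autocorr (c * t)"
      using sum_translate[of "c * t" "\<lambda>x. g (x + c * t) * g x"] t c
      by (simp add: autocorr_def mult.commute)
    finally show "autocorr t * (\<Sum>x\<in>K. g (c * x) * g (c * x - c * t)) = autocorr t * autocorr (c * t)"
      by simp
  qed
  finally show ?thesis .
qed

text \<open>Put \<open>S = autocorr 0\<close>. The terms with \<open>t = 0\<close> contribute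
  \<open>(card K - 1) * S * S\<close>. For \<open>t \<noteq> 0\<close> the product
  \<open>c * t\<close> runs through all units, on which \<open>autocorr\<close> sums to
  \<open>- S\<close>; these terms contribute \<open>S * S\<close> altogether.\<close>

lemma sum_sum_conv_square:
  "(\<Sum>c\<in>K - {0}. \<Sum>y\<in>K. (conv c y)\<^sup>2) = real (card K) * (\<Sum>x\<in>K. (g x)\<^sup>2)\<^sup>2"
proof -
  define S where "S = (\<Sum>x\<in>K. (g x)\<^sup>2)"
  have R0: "autocorr 0 = S" by (simp add: autocorr_def S_def power2_eq_square)
  have units: "(\<Sum>t\<in>K - {0}. autocorr t) = - S"
    using sum_autocorr R0 by (simp add: sum.remove[of K 0])
  have Q: "real (card (K - {0})) = real (card K) - 1"
    by (metis card_Diff_singleton card_gt_0_iff empty_iff finite_K of_nat_1 of_nat_diff Suc_leI One_nat_def zero_mem)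
  have "(\<Sum>c\<in>K - {0}. \<Sum>y\<in>K. (conv c y)\<^sup>2) = (\<Sum>c\<in>K - {0}. \<Sum>t\<in>K. autocorr t * autocorr (c * t))"
    by (intro sum.cong refl sum_conv_square)
  also have "\<dots> = (\<Sum>t\<in>K. autocorr t * (\<Sum>c\<in>K - {0}. autocorr (c * t)))"
    by (subst sum.swap) (simp add: sum_distrib_left)
  also have "\<dots> = autocorr 0 * (\<Sum>c\<in>K - {0}. autocorr 0) + (\<Sum>t\<in>K - {0}. autocorr t * (\<Sum>c\<in>K - {0}. autocorr (c * t)))"
    by (simp add: sum.remove[of K 0])
  also have "(\<Sum>t\<in>K - {0}. autocorr t * (\<Sum>c\<in>K - {0}. autocorr (c * t))) = (\<Sum>t\<in>K - {0}. autocorr t * (- S))"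
    by (intro sum.cong refl) (simp only: sum_units_scale units)
  also have "\<dots> = S * S" by (simp only: sum_distrib_right[symmetric] units minus_mult_minus)
  also have "autocorr 0 * (\<Sum>c\<in>K - {0}. autocorr 0) = (real (card K) - 1) * S * S"
    using R0 Q by simp
  finally show ?thesis
    unfolding S_def[symmetric] by (simp add: power2_eq_square[of S] algebra_simps)
qed

end

text \<open>Without a representation of \<open>l\<close>, the deviation at \<open>(1, l)\<close>
  takes the extreme value \<open>- Q\<close>. Invariance under \<open>H\<close> spreads this value
  over all of \<open>H \<times> l H\<close>, which is too much for the second moment once
  \<open>Q > (k - 1) ^ 4\<close>.\<close>

lemma unit_eq_sum_of_subgroup:
  assumes H: "H \<subseteq> K - {0}" "1 \<in> H"
    and mult: "\<And>x y. x \<in> H \<Longrightarrow> y \<in> H \<Longrightarrow> x * y \<in> H"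
    and inv: "\<And>x. x \<in> H \<Longrightarrow> inverse x \<in> H"
    and index: "card K - 1 \<le> k * card H" and large: "card K > (k - 1) ^ 4"
    and l: "l \<in> K - {0}"
  shows "\<exists>x\<in>insert 0 H. \<exists>y\<in>insert 0 H. x + y = l"
proof (rule ccontr)
  assume none: "\<not> ?thesis"
  have finH: "finite H" using H finite_subset[of H K] by auto
  define h Q d where "h = real (card H)" and "Q = real (card K)" and "d = (Q - 1) / h"
  have h: "h > 0" using H finH by (auto simp: h_def card_gt_0_iff)
  have K1: "card K \<ge> 1" using card_gt_0_iff[of K] by (metis One_nat_def Suc_leI empty_iff finite_K zero_mem)
  have Kunits: "real (card (K - {0})) = Q - 1"
    using K1 by (simp add: card_Diff_singleton Q_def of_nat_diff)
  have hQ: "h \<le> Q - 1" using card_mono[of "K - {0}" H] H Kunits by (simp add: h_def)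
  have dh: "d * h = Q - 1" using h by (simp add: d_def)
  have d1: "d \<ge> 1" using hQ h by (simp add: d_def)
  have dk: "d \<le> real k"
  proof -
    have "real (card K - 1) \<le> real (k * card H)" using index of_nat_le_iff by blast
    then have "Q - 1 \<le> real k * h" using K1 by (simp add: Q_def h_def of_nat_diff)
    then show ?thesis using h by (simp add: d_def divide_simps)
  qed
  \<comment> \<open>Here \<open>d\<close> is the index of \<open>H\<close>, and \<open>g + 1\<close>
    is \<open>d\<close> on \<open>H\<close>, 1 at 0 and 0 elsewhere. This weight has mean one on
    \<open>K\<close>, so \<open>g\<close> sums to zero.\<close>
  define g where "g x = (if x = 0 then 0 else if x \<in> H then d - 1 else - 1)" for x :: 'b
  have g_units: "(\<Sum>x\<in>K. F (g x)) = F 0 + h * F (d - 1) + (Q - 1 - h) * F (- 1)" for F :: "real \<Rightarrow> real"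
  proof -
    have "(\<Sum>x\<in>K. F (g x)) = F (g 0) + (\<Sum>x\<in>K - {0}. F (g x))"
      by (simp add: sum.remove[of K 0])
    also have "(\<Sum>x\<in>K - {0}. F (g x)) = (\<Sum>x\<in>K - {0} - H. F (g x)) + (\<Sum>x\<in>H. F (g x))"
      using H by (intro sum.subset_diff) auto
    also have "(\<Sum>x\<in>H. F (g x)) = (\<Sum>x\<in>H. F (d - 1))"
      using H by (intro sum.cong) (auto simp: g_def)
    also have "(\<Sum>x\<in>K - {0} - H. F (g x)) = (\<Sum>x\<in>K - {0} - H. F (- 1))"
      by (intro sum.cong) (auto simp: g_def)
    finally have "(\<Sum>x\<in>K. F (g x)) = F 0 + h * F (d - 1) + real (card (K - {0} - H)) * F (- 1)"
      by (simp add: g_def h_def)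
    moreover have "real (card (K - {0} - H)) = Q - 1 - h"
      using card_Diff_subset[OF finH H(1)] card_mono[OF _ H(1)] Kunits by (simp add: h_def of_nat_diff)
    ultimately show ?thesis by simp
  qed
  have g0: "g 0 = 0" by (simp add: g_def)
  have sum_g: "(\<Sum>x\<in>K. g x) = 0"
    using g_units[of "\<lambda>x. x"] dh by (simp add: algebra_simps)
  have sum_g2: "(\<Sum>x\<in>K. (g x)\<^sup>2) = h * d * (d - 1)"
  proof -
    have "(\<Sum>x\<in>K. (g x)\<^sup>2) = h * (d - 1)\<^sup>2 + (d * h - h)"
      using g_units[of "\<lambda>x. x\<^sup>2"] dh by simp
    then show ?thesis by (simp add: power2_eq_square algebra_simps)
  qed
  define W where "W = conv g"
  have Wdef: "W c y = (\<Sum>x\<in>K. g (c * x) * g (y - x))" for c y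
    by (simp add: W_def conv_def[OF g0 sum_g])
  have W1: "W 1 l = - Q"
  proof -
    \<comment> \<open>A nonzero term would need both \<open>x\<close> and \<open>l - x\<close> in
      \<open>insert 0 H\<close>, that is, a representation of \<open>l\<close>. Expanding the same
      sum then isolates \<open>W 1 l\<close>.\<close>
    have "(\<Sum>x\<in>K. (1 + g x) * (1 + g (l - x))) = 0"
    proof (rule sum.neutral, rule ballI)
      fix x assume "x \<in> K"
      have "x \<notin> insert 0 H \<or> l - x \<notin> insert 0 H"
        using none by (metis add.commute diff_add_cancel)
      then show "(1 + g x) * (1 + g (l - x)) = 0" by (auto simp: g_def)
    qed
    moreover have "(\<Sum>x\<in>K. (1 + g x) * (1 + g (l - x))) =
        Q + (\<Sum>x\<in>K. g (l - x)) + (\<Sum>x\<in>K. g x) + W 1 l"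
      by (simp add: Wdef algebra_simps sum.distrib Q_def)
    ultimately show ?thesis using sum_g sum_reflect[of l g] l by simp
  qed
  have g_inv: "g (u * x) = g x" if "u \<in> H" for u x
  proof -
    have "u \<noteq> 0" using that H by auto
    moreover have "u * x \<in> H \<longleftrightarrow> x \<in> H"
      using mult[OF that, of x] mult[OF inv[OF that], of "u * x"] \<open>u \<noteq> 0\<close> by (auto simp: mult.assoc[symmetric])
    ultimately show ?thesis by (simp add: g_def)
  qed
  have WH: "W c (l * u) = - Q" if "c \<in> H" "u \<in> H" for c u
  proof -
    have u: "u \<in> K - {0}" using that H by auto
    \<comment> \<open>Substitute \<open>u * x\<close> for \<open>x\<close>; the
      \<open>H\<close>-invariance of \<open>g\<close> then absorbs both \<open>c\<close> and
      \<open>u\<close>.\<close>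
    have "W c (l * u) = (\<Sum>x\<in>K. g (c * (u * x)) * g (l * u - u * x))"
      unfolding Wdef by (rule sum_scale[OF u, symmetric])
    also have "\<dots> = (\<Sum>x\<in>K. g x * g (u * (l - x)))"
      using that by (simp add: g_inv right_diff_distrib mult.commute[of l u])
    also have "\<dots> = W 1 l" using that by (simp add: g_inv Wdef)
    finally show ?thesis using W1 by simp
  qed
  define \<iota> where "\<iota> c = (if c \<in> H then 1 else 0 :: real)" for c :: 'b
  define \<kappa> where "\<kappa> y = (if y \<in> (\<lambda>u. l * u) ` H then 1 else 0 :: real)" for y :: 'b
  txt \<open>
    Cauchy-Schwarz is applied to \<open>W\<close> and the indicator of \<open>H \<times> l H\<close>, on which \<open>W = - Q\<close>. Removing the
    means of the indicator in both variables costs nothing, as the marginals of \<open>W\<close> vanish, and it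
    gains the factors needed to get down to the exponent in \<open>Q > (k - 1) ^ 4\<close>.
  \<close>
  define T where "T c y = (\<iota> c - 1 / d) * (\<kappa> y - h / Q)" for c y
  have lH: "(\<lambda>u. l * u) ` H \<subseteq> K" "card ((\<lambda>u. l * u) ` H) = card H"
    using l H by (auto intro!: card_image inj_onI)
  have sum_iota: "(\<Sum>c\<in>K - {0}. \<iota> c * \<phi> c) = (\<Sum>c\<in>H. \<phi> c)" for \<phi>
    using H by (intro sum.mono_neutral_cong_right) (auto simp: \<iota>_def)
  have sum_kappa: "(\<Sum>y\<in>K. \<kappa> y * \<phi> y) = (\<Sum>u\<in>H. \<phi> (l * u))" for \<phi>
  proof -
    have "(\<Sum>y\<in>K. \<kappa> y * \<phi> y) = (\<Sum>y\<in>(\<lambda>u. l * u) ` H. \<phi> y)"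
      using lH by (intro sum.mono_neutral_cong_right) (auto simp: \<kappa>_def)
    then show ?thesis using l by (simp add: sum.reindex inj_on_def)
  qed
  have WT: "(\<Sum>c\<in>K - {0}. \<Sum>y\<in>K. W c y * T c y) = - Q * h\<^sup>2"
  proof -
    have inner: "(\<Sum>y\<in>K. W c y * T c y) = (\<iota> c - 1 / d) * (\<Sum>u\<in>H. W c (l * u))" for c
    proof -
      have "(\<Sum>y\<in>K. W c y * T c y) = (\<iota> c - 1 / d) * ((\<Sum>y\<in>K. \<kappa> y * W c y) - (\<Sum>y\<in>K. W c y) * (h / Q))"
        unfolding T_def sum_distrib_right sum_subtractf[symmetric] sum_distrib_left
        by (intro sum.cong refl) (simp add: algebra_simps diff_divide_distrib)
      then show ?thesis using sum_conv_right[OF g0 sum_g, of c] by (simp add: sum_kappa W_def)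
    qed
    have "(\<Sum>c\<in>K - {0}. (\<iota> c - 1 / d) * (\<Sum>u\<in>H. W c (l * u))) =
      (\<Sum>c\<in>K - {0}. \<iota> c * (\<Sum>u\<in>H. W c (l * u))) - (1 / d) * (\<Sum>c\<in>K - {0}. \<Sum>u\<in>H. W c (l * u))"
      by (simp add: sum_distrib_left sum_subtractf algebra_simps)
    also have "(\<Sum>c\<in>K - {0}. \<Sum>u\<in>H. W c (l * u)) = 0"
      using H l by (subst sum.swap) (auto intro!: sum.neutral simp: W_def sum_conv_left[OF g0 sum_g] subset_iff)
    also have "(\<Sum>c\<in>K - {0}. \<iota> c * (\<Sum>u\<in>H. W c (l * u))) = (\<Sum>c\<in>H. \<Sum>u\<in>H. - Q)"
      unfolding sum_iota by (intro sum.cong refl WH)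
    finally show ?thesis by (simp add: inner h_def power2_eq_square)
  qed
  \<comment> \<open>\<open>1 / d = h / (Q - 1)\<close> and \<open>h / Q\<close> are the means of the
    two indicators, so the double sum is a product of two sums of squared deviations.\<close>
  have TT: "(\<Sum>c\<in>K - {0}. \<Sum>y\<in>K. (T c y)\<^sup>2) = h * (1 - 1 / d) * (h * (1 - h / Q))"
  proof -
    have "(\<Sum>c\<in>K - {0}. (\<iota> c - 1 / d)\<^sup>2) = (\<Sum>c\<in>K - {0}. \<iota> c * (1 - 2 / d) + (1 / d)\<^sup>2)"
      by (intro sum.cong refl) (auto simp: \<iota>_def power2_eq_square algebra_simps)
    also have "\<dots> = h * (1 - 2 / d) + (Q - 1) * (1 / d)\<^sup>2"
      using Kunits by (simp add: sum.distrib sum_iota h_def)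
    also have "\<dots> = h * (1 - 1 / d)"
      using d1 by (simp add: dh[symmetric] field_simps power2_eq_square)
    finally have 1: "(\<Sum>c\<in>K - {0}. (\<iota> c - 1 / d)\<^sup>2) = h * (1 - 1 / d)" .
    have "(\<Sum>y\<in>K. (\<kappa> y - h / Q)\<^sup>2) = (\<Sum>y\<in>K. \<kappa> y * (1 - 2 * (h / Q)) + (h / Q)\<^sup>2)"
      by (intro sum.cong refl) (auto simp: \<kappa>_def power2_eq_square algebra_simps)
    also have "\<dots> = h * (1 - 2 * (h / Q)) + Q * (h / Q)\<^sup>2"
      by (simp add: sum.distrib sum_kappa h_def Q_def)
    also have "\<dots> = h * (1 - h / Q)"
      using hQ h by (simp add: field_simps power2_eq_square)
    finally have 2: "(\<Sum>y\<in>K. (\<kappa> y - h / Q)\<^sup>2) = h * (1 - h / Q)" .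
    have "(\<Sum>c\<in>K - {0}. \<Sum>y\<in>K. (T c y)\<^sup>2) = (\<Sum>c\<in>K - {0}. (\<iota> c - 1 / d)\<^sup>2) * (\<Sum>y\<in>K. (\<kappa> y - h / Q)\<^sup>2)"
      by (simp add: T_def power_mult_distrib sum_product)
    then show ?thesis by (simp only: 1 2)
  qed
  have WW: "(\<Sum>c\<in>K - {0}. \<Sum>y\<in>K. (W c y)\<^sup>2) = Q * (h * d * (d - 1))\<^sup>2"
    unfolding W_def using sum_sum_conv_square[OF g0 sum_g] sum_g2 by (simp add: Q_def)
  have CS: "(- Q * h\<^sup>2)\<^sup>2 \<le> (Q * (h * d * (d - 1))\<^sup>2) * (h * (1 - 1 / d) * (h * (1 - h / Q)))"
    using Cauchy_Schwarz_ineq_sum[of "\<lambda>(c, y). W c y" "\<lambda>(c, y). T c y" "(K - {0}) \<times> K"]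
    by (simp only: case_prod_unfold fst_conv snd_conv) (simp add: sum.cartesian_product' WT TT WW)
  have main: "Q\<^sup>2 \<le> (d - 1) ^ 3 * ((d - 1) * Q + 1)"
  proof -
    have "(Q * (h * d * (d - 1))\<^sup>2) * (h * (1 - 1 / d) * (h * (1 - h / Q))) =
       h ^ 4 * ((d - 1) ^ 3 * (d * Q - d * h))"
      using d1 hQ h by (simp add: field_simps power2_eq_square power3_eq_cube power4_eq_xxxx)
    also have "d * Q - d * h = (d - 1) * Q + 1" using dh by (simp add: algebra_simps)
    finally have "h ^ 4 * Q\<^sup>2 \<le> h ^ 4 * ((d - 1) ^ 3 * ((d - 1) * Q + 1))"
      using CS by (simp add: power2_eq_square power4_eq_xxxx algebra_simps)
    then show ?thesis using h by simp
  qed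
  define m where "m = real (k - 1)"
  have k1: "k \<ge> 1" using dk d1 by linarith
  have m: "d - 1 \<le> m" "0 \<le> m" using dk k1 by (auto simp: m_def of_nat_diff)
  have Qm: "Q \<ge> m ^ 4 + 1"
  proof -
    have "real ((k - 1) ^ 4 + 1) \<le> real (card K)" using large by (intro of_nat_mono) simp
    then show ?thesis by (simp add: Q_def m_def)
  qed
  \<comment> \<open>The lower-order term \<open>m ^ 3\<close> is less than \<open>Q\<close>, so the
    bound yields \<open>Q * Q < (m ^ 4 + 1) * Q\<close>, contrary to
    \<open>Q \<ge> m ^ 4 + 1\<close>.\<close>
  have "(d - 1) ^ 3 * ((d - 1) * Q + 1) \<le> m ^ 3 * (m * Q + 1)"
    using m d1 hQ h by (intro mult_mono power_mono add_mono mult_right_mono) auto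
  with main have "Q\<^sup>2 \<le> m ^ 3 * (m * Q + 1)" by simp
  also have "\<dots> = m ^ 4 * Q + m ^ 3" by (simp add: algebra_simps power3_eq_cube power4_eq_xxxx)
  also have "\<dots> < m ^ 4 * Q + Q"
  proof -
    have "m ^ 3 \<le> m ^ 4"
    proof (cases "k = 1")
      case False
      then have "m \<ge> 1" using k1 by (simp add: m_def)
      then show ?thesis by (intro power_increasing) auto
    qed (simp add: m_def)
    then show ?thesis using Qm by linarith
  qed
  also have "\<dots> = (m ^ 4 + 1) * Q" by (simp add: algebra_simps)
  also have "\<dots> \<le> Q * Q" using Qm h hQ by (intro mult_right_mono) auto
  finally show False by (simp add: power2_eq_square)
qed

end

section \<open>Power maps on a finite field\<close>

lemma card_nth_roots_le:
  fixes a :: "'b::field"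
  assumes "k \<ge> 1"
  shows "finite {x. x ^ k = a}" and "card {x. x ^ k = a} \<le> k"
proof -
  let ?p = "monom 1 k - [:a:]"
  have "coeff ?p k \<noteq> 0" using assms by (simp add: coeff_pCons split: nat.splits)
  then have p: "?p \<noteq> 0" by (metis coeff_0)
  have roots: "{x. poly ?p x = 0} = {x. x ^ k = a}" by (simp add: poly_monom)
  show "finite {x. x ^ k = a}" using poly_roots_finite[OF p] roots by simp
  have "degree ?p \<le> k" by (intro degree_diff_le) (auto simp: degree_monom_eq)
  then show "card {x. x ^ k = a} \<le> k" using card_poly_roots_bound[OF p] roots by simp
qed

lemma card_le_mult_card_image:
  assumes "finite A" and fibres: "\<And>b. b \<in> f ` A \<Longrightarrow> card {a \<in> A. f a = b} \<le> k"
  shows "card A \<le> k * card (f ` A)"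
proof -
  have "A = (\<Union>b\<in>f ` A. {a \<in> A. f a = b})" by auto
  then have "card A \<le> (\<Sum>b\<in>f ` A. card {a \<in> A. f a = b})"
    using card_UN_le[of "f ` A" "\<lambda>b. {a \<in> A. f a = b}"] assms(1) by simp
  also have "\<dots> \<le> (\<Sum>b\<in>f ` A. k)" by (intro sum_mono fibres)
  finally show ?thesis by (simp add: mult.commute)
qed

context finite_subfield
begin

text \<open>Multiplication by \<open>x\<close> permutes the units, so their product is unchanged
  when it is multiplied by \<open>x ^ (card K - 1)\<close>.\<close>

lemma power_card_minus_one:
  assumes "x \<in> K - {0}"
  shows "x ^ (card K - 1) = 1"
proof -
  have "(\<Prod>y\<in>K - {0}. y) = (\<Prod>y\<in>K - {0}. x * y)"
    using assms by (intro prod.reindex_bij_witness[of _ "\<lambda>y. x * y" "\<lambda>y. y / x"]) auto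
  also have "\<dots> = x ^ (card K - 1) * (\<Prod>y\<in>K - {0}. y)"
    by (simp add: prod.distrib card_Diff_singleton)
  finally show ?thesis by simp
qed

lemma card_pos: "card K > 0"
  by (metis card_gt_0_iff empty_iff finite_K zero_mem)

lemma power_card: "x \<in> K \<Longrightarrow> x ^ card K = x"
  using power_card_minus_one[of x] card_pos power_minus_mult[of "card K" x]
  by (cases "x = 0") (auto simp: zero_power)

lemma sum_of_two_powers:
  assumes k: "k \<ge> 1" and large: "card K > (k - 1) ^ 4" and l: "l \<in> K"
  shows "\<exists>x\<in>K. \<exists>y\<in>K. l = x ^ k + y ^ k"
proof (cases "l = 0")
  case True
  then show ?thesis using k by (intro bexI[of _ 0]) (auto simp: zero_power)
next
  case False
  let ?H = "(\<lambda>x. x ^ k) ` (K - {0})"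
  \<comment> \<open>The fibres of the power map are sets of \<open>k\<close>-th roots, so the
    subgroup of \<open>k\<close>-th powers has index at most \<open>k\<close>.\<close>
  have "card {x \<in> K - {0}. x ^ k = a} \<le> k" for a
    using card_mono[OF card_nth_roots_le(1)[OF k, of a], of "{x \<in> K - {0}. x ^ k = a}"]
      card_nth_roots_le(2)[OF k, of a] by fastforce
  then have "card (K - {0}) \<le> k * card ?H"
    by (intro card_le_mult_card_image) auto
  then have index: "card K - 1 \<le> k * card ?H" by (simp add: card_Diff_singleton)
  have "\<exists>x\<in>insert 0 ?H. \<exists>y\<in>insert 0 ?H. x + y = l"
  proof (rule unit_eq_sum_of_subgroup[OF _ _ _ _ index large])
    show "1 \<in> ?H" by (intro image_eqI[of _ _ 1]) auto
    show "x * y \<in> ?H" if "x \<in> ?H" "y \<in> ?H" for x y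
      using that by (auto simp: power_mult_distrib[symmetric])
    show "inverse x \<in> ?H" if "x \<in> ?H" for x
      using that by (auto simp: power_inverse[symmetric])
  qed (use False l in auto)
  moreover have "\<exists>x\<in>K. z = x ^ k" if "z \<in> insert 0 ?H" for z
  proof -
    have "z = 0 ^ k \<or> z \<in> ?H" using that k by (auto simp: zero_power)
    then show ?thesis by auto
  qed
  ultimately show ?thesis by metis
qed

end

section \<open>Extension fields as matrix algebras\<close>

lemma finite_subfield_UNIV: "finite_subfield (UNIV :: 'a::{field,finite} set)"
  by unfold_locales auto

text \<open>Translation by 1 permutes the field; comparing the sums of all elements shows that the
  cardinality vanishes in the field.\<close>

lemma CHAR_finite_field:
  assumes "prime p" "CARD('a::{field,finite}) = p ^ l"
  shows "CHAR('a) = p"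
proof -
  have "(\<Sum>x\<in>(UNIV :: 'a set). x) = (\<Sum>x\<in>UNIV. x + 1)"
    by (rule sum.reindex_bij_witness[of _ "\<lambda>x. x + 1" "\<lambda>x. x - 1"]) auto
  then have "of_nat (p ^ l) = (0 :: 'a)" using assms(2) by (simp add: sum.distrib)
  then have "of_nat p = (0 :: 'a)" by simp
  then have "CHAR('a) dvd p" using of_nat_eq_0_iff_char_dvd by blast
  then show ?thesis using assms(1) by (metis CHAR_not_1' One_nat_def prime_nat_iff)
qed

text \<open>With \<open>Q = p ^ m\<close>, the polynomial \<open>X ^ Q - X\<close> splits into
  linear factors and has derivative \<open>- 1\<close>. A repeated factor would make the derivative
  vanish at its root, so there are \<open>Q\<close> distinct roots.\<close>

lemma card_frobenius_fixed_points:
  fixes K :: "'b::alg_closed_field set"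
  assumes p: "prime p" "CHAR('b) = p" and m: "m \<ge> 1" and K: "K = {x. x ^ (p ^ m) = x}"
  shows "card K = p ^ m"
proof -
  let ?Q = "p ^ m"
  have Q: "?Q > 1" using p m by (metis one_less_power prime_gt_1_nat Suc_le_eq One_nat_def)
  let ?p = "monom 1 ?Q - [:0, 1 :: 'b:]"
  have deg: "degree ?p = ?Q"
    using Q degree_add_eq_left[of "- [:0, 1 :: 'b:]" "monom 1 ?Q"]
    by (simp only: diff_conv_add_uminus) (simp add: degree_monom_eq)
  then have p0: "?p \<noteq> 0" using Q by (metis degree_0 less_nat_zero_code)
  define c where "c = coeff ?p (degree ?p)"
  have c: "c \<noteq> 0" using p0 by (simp add: c_def leading_coeff_0_iff del: coeff_diff)
  obtain A where A: "size A = degree ?p" "?p = smult c (\<Prod>x\<in>#A. [:- x, 1:])"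
    using alg_closed_imp_factorization[OF p0] unfolding c_def by blast
  have "poly ?p x = 0 \<longleftrightarrow> x \<in># A" for x
  proof -
    have "poly ?p x = c * poly (\<Prod>x\<in>#A. [:- x, 1:]) x" by (subst A(2)) simp
    then show ?thesis using c by (auto simp: poly_prod_mset)
  qed
  then have roots: "set_mset A = {x. poly ?p x = 0}" by auto
  have "of_nat p = (0 :: 'b)" using p(2) of_nat_CHAR by metis
  then have "of_nat ?Q = (0 :: 'b)" using m by (simp add: zero_power)
  then have deriv: "pderiv ?p = - 1"
    by (simp add: pderiv_diff pderiv_monom pderiv_pCons one_pCons zero_power)
  have "count A a \<le> 1" for a
  proof (rule ccontr)
    assume "\<not> ?thesis"
    then have "a \<in># A" "a \<in># A - {#a#}"
      by (auto simp: in_diff_count simp flip: count_greater_zero_iff)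
    then have B: "A = add_mset a (add_mset a (A - {#a#} - {#a#}))"
      by (metis insert_DiffM)
    define r where "r = smult c (\<Prod>x\<in>#A - {#a#} - {#a#}. [:- x, 1:])"
    have "?p = [:- a, 1:] * ([:- a, 1:] * r)"
      by (subst A(2), subst B) (simp add: r_def mult_ac)
    then have "poly (pderiv ?p) a = 0" by (simp only: pderiv_mult poly_add poly_mult) simp
    then show False by (simp add: deriv)
  qed
  then have "count A a = 1" if "a \<in># A" for a
    using that by (metis One_nat_def Suc_leI count_greater_zero_iff le_antisym)
  then have "card (set_mset A) = ?Q" using A(1) deg by (simp add: size_multiset_overloaded_eq)
  then show ?thesis unfolding roots K by (simp add: poly_monom)
qed

lemma finite_subfield_frobenius_fixed_points:
  fixes K :: "'b::alg_closed_field set"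
  assumes p: "prime p" "CHAR('b) = p" and m: "m \<ge> 1" and K: "K = {x. x ^ (p ^ m) = x}"
  shows "finite_subfield K"
proof
  have Q: "p ^ m > 0" using p prime_gt_0_nat by simp
  show "finite K"
    using card_frobenius_fixed_points[OF assms] Q by (metis card.infinite less_numeral_extra(3))
  have add: "(x + y) ^ (p ^ m) = x ^ (p ^ m) + y ^ (p ^ m)" for x y :: 'b
    using freshmans_dream'[of "p ^ m" m x y] p by simp
  show "x + y \<in> K" if "x \<in> K" "y \<in> K" for x y using that by (simp add: K add)
  show "- x \<in> K" if "x \<in> K" for x
  proof -
    have "x ^ (p ^ m) + (- x) ^ (p ^ m) = 0" using add[of x "- x"] Q by (simp add: zero_power)
    then show ?thesis using that by (simp add: K eq_neg_iff_add_eq_0 add.commute)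
  qed
qed (use p in \<open>auto simp: K power_mult_distrib power_inverse zero_power prime_gt_0_nat\<close>)

section \<open>Finite extensions as vector spaces over the base field\<close>

interpretation to_ac_vs: vector_space "\<lambda>(a :: 'a::field) x. to_ac a * x"
  by unfold_locales (auto simp: algebra_simps)

text \<open>Counting stands in for dimension: comparing cardinalities shows that a basis of a field
  with \<open>CARD('a) ^ n\<close> elements has \<open>n\<close> members.\<close>

lemma card_span_independent:
  fixes B :: "'a::{field,finite} alg_closure set"
  assumes "finite B" "to_ac_vs.independent B"
  shows "card (to_ac_vs.span B) = CARD('a) ^ card B \<and> finite (to_ac_vs.span B)"
  using assms
proof (induction B rule: finite_induct)
  case empty
  then show ?case by simp
next
  case (insert b B)
  have ind: "to_ac_vs.independent B" "b \<notin> to_ac_vs.span B"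
    using insert by (auto simp: to_ac_vs.independent_insert)
  let ?f = "\<lambda>(a, x). to_ac a * b + x"
  have "to_ac_vs.span (insert b B) = ?f ` (UNIV \<times> to_ac_vs.span B)"
  proof (intro Set.set_eqI iffI)
    fix x assume "x \<in> to_ac_vs.span (insert b B)"
    then obtain a where "x - to_ac a * b \<in> to_ac_vs.span B" by (auto simp: to_ac_vs.span_insert)
    then show "x \<in> ?f ` (UNIV \<times> to_ac_vs.span B)"
      by (intro image_eqI[of _ _ "(a, x - to_ac a * b)"]) auto
  next
    fix x assume "x \<in> ?f ` (UNIV \<times> to_ac_vs.span B)"
    then obtain a y where ay: "x = to_ac a * b + y" "y \<in> to_ac_vs.span B" by auto
    have "x - to_ac a * b \<in> to_ac_vs.span B" using ay by simp
    then show "x \<in> to_ac_vs.span (insert b B)" unfolding to_ac_vs.span_insert by blast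
  qed
  moreover have "inj_on ?f (UNIV \<times> to_ac_vs.span B)"
  proof (rule inj_onI, clarify)
    fix a c x y
    assume xy: "x \<in> to_ac_vs.span B" "y \<in> to_ac_vs.span B" and eq: "to_ac a * b + x = to_ac c * b + y"
    have e: "to_ac (a - c) * b = y - x" using eq by (simp add: algebra_simps)
    have "a = c"
    proof (rule ccontr)
      assume ne: "a \<noteq> c"
      have "b = to_ac (inverse (a - c)) * (to_ac (a - c) * b)"
        using ne by (simp flip: mult.assoc to_ac_mult)
      also have "\<dots> \<in> to_ac_vs.span B"
        unfolding e by (intro to_ac_vs.span_scale to_ac_vs.span_diff xy)
      finally show False using ind by blast
    qed
    then show "a = c \<and> x = y" using eq by simp
  qed
  ultimately show ?case using insert ind by (simp add: card_image card_cartesian_product)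
qed

text \<open>\<open>R x\<close> is the matrix of multiplication by \<open>x\<close> in a basis of
  \<open>K\<close> over the base field: its column \<open>j\<close> holds the coordinates of
  \<open>x * bs ! j\<close>.\<close>

lemma regular_representation:
  fixes K :: "'a::{field,finite} alg_closure set"
  assumes K: "finite_subfield K" and F: "range to_ac \<subseteq> K" and card: "card K = CARD('a) ^ n"
  obtains R :: "'a alg_closure \<Rightarrow> 'a mat"
  where "\<And>x. R x \<in> carrier_mat n n"
    and "\<And>x y. x \<in> K \<Longrightarrow> y \<in> K \<Longrightarrow> R (x + y) = R x + R y"
    and "\<And>x y. x \<in> K \<Longrightarrow> y \<in> K \<Longrightarrow> R (x * y) = R x * R y"
    and "\<And>a. R (to_ac a) = a \<cdot>\<^sub>m 1\<^sub>m n"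
proof -
  interpret finite_subfield K by fact
  obtain B where B: "B \<subseteq> K" "to_ac_vs.independent B" "K \<subseteq> to_ac_vs.span B"
    using to_ac_vs.maximal_independent_subset by blast
  have finB: "finite B" using B(1) finite_K finite_subset by blast
  have "to_ac_vs.subspace K"
    using F by (auto simp: to_ac_vs.subspace_def image_subset_iff)
  then have span: "to_ac_vs.span B = K"
    using B to_ac_vs.span_minimal by blast
  have "CARD('a) ^ card B = CARD('a) ^ n"
    using card_span_independent[OF finB B(2)] span card by simp
  moreover have "CARD('a) > 1"
    using card_mono[of "UNIV :: 'a set" "{0, 1}"] by simp
  ultimately have cardB: "card B = n" by simp
  obtain bs where bs: "set bs = B" "distinct bs" using finite_distinct_list[OF finB] by blast
  then have len: "length bs = n" using cardB distinct_card by metis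
  define rep where "rep = to_ac_vs.representation B"
  define R where "R x = mat n n (\<lambda>(i, j). rep (x * bs ! j) (bs ! i))" for x
  have mem: "bs ! i \<in> K" "bs ! i \<in> B" if "i < n" for i using that len bs B by auto
  have rep_add: "rep (x + y) b = rep x b + rep y b" if "x \<in> K" "y \<in> K" for x y b
    using to_ac_vs.representation_add[OF B(2), of y x] that by (simp add: span rep_def)
  have rep_scale: "rep (to_ac a * x) b = a * rep x b" if "x \<in> K" for a x b
    using to_ac_vs.representation_scale[OF B(2), of x a] that by (simp add: span rep_def)
  have rep_sum: "rep (\<Sum>i\<in>I. f i) b = (\<Sum>i\<in>I. rep (f i) b)" if "\<And>i. i \<in> I \<Longrightarrow> f i \<in> K" for I f b
    using to_ac_vs.representation_sum[OF B(2), of I f] that by (simp add: span rep_def)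
  have expand: "(\<Sum>l<n. to_ac (rep x (bs ! l)) * bs ! l) = x" if "x \<in> K" for x
  proof -
    have "(\<Sum>l<n. to_ac (rep x (bs ! l)) * bs ! l) = (\<Sum>b\<in>B. to_ac (rep x b) * b)"
      using bs len by (intro sum.reindex_bij_betw bij_betw_nth) auto
    then show ?thesis
      using to_ac_vs.sum_representation_eq[OF B(2), of x B] that finB span by (simp add: rep_def)
  qed
  have rep_basis: "rep (bs ! j) (bs ! i) = (if i = j then 1 else 0)" if "i < n" "j < n" for i j
    using to_ac_vs.representation_basis[OF B(2) mem(2)[OF that(2)]] that bs len
    by (auto simp: rep_def nth_eq_iff_index_eq)
  show ?thesis
  proof
    show "R x \<in> carrier_mat n n" for x by (simp add: R_def)
    show "R (x + y) = R x + R y" if "x \<in> K" "y \<in> K" for x y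
      using that mem by (intro eq_matI) (auto simp: R_def distrib_right rep_add)
    show "R (to_ac a) = a \<cdot>\<^sub>m 1\<^sub>m n" for a
      using mem by (intro eq_matI) (auto simp: R_def rep_scale rep_basis)
    show "R (x * y) = R x * R y" if xy: "x \<in> K" "y \<in> K" for x y
    proof (rule eq_matI)
      fix i j assume "i < dim_row (R x * R y)" "j < dim_col (R x * R y)"
      then have ij: "i < n" "j < n" by (auto simp: R_def)
      have "x * y * bs ! j = x * (\<Sum>l<n. to_ac (rep (y * bs ! j) (bs ! l)) * bs ! l)"
        using expand[of "y * bs ! j"] xy mem ij by (simp add: mult.assoc)
      also have "\<dots> = (\<Sum>l<n. to_ac (rep (y * bs ! j) (bs ! l)) * (x * bs ! l))"
        by (simp add: sum_distrib_left algebra_simps)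
      finally have "rep (x * y * bs ! j) (bs ! i) =
          (\<Sum>l<n. rep (to_ac (rep (y * bs ! j) (bs ! l)) * (x * bs ! l)) (bs ! i))"
        using xy mem F by (simp only:) (intro rep_sum, auto simp: image_subset_iff)
      also have "\<dots> = (\<Sum>l<n. rep (y * bs ! j) (bs ! l) * rep (x * bs ! l) (bs ! i))"
        using xy mem by (intro sum.cong refl rep_scale) auto
      finally show "R (x * y) $$ (i, j) = (R x * R y) $$ (i, j)"
        using ij by (simp add: R_def scalar_prod_def atLeast0LessThan mult.commute)
    qed (auto simp: R_def)
  qed
qed

lemma scalar_mat_sum_of_two_powers:
  fixes l :: "'a::{field,finite}"
  assumes p: "prime p" "CARD('a) = p ^ e" and n: "n \<ge> 1" and k: "k \<ge> 1"
    and large: "(k - 1) ^ 4 < CARD('a) ^ n"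
  shows "\<exists>A\<in>carrier_mat n n. \<exists>B\<in>carrier_mat n n. l \<cdot>\<^sub>m 1\<^sub>m n = A ^\<^sub>m k + B ^\<^sub>m k"
proof -
  define K where "K = {x :: 'a alg_closure. x ^ (p ^ (e * n)) = x}"
  have char: "CHAR('a alg_closure) = p" using CHAR_finite_field[OF p] by simp
  have "CARD('a) > 1"
    using card_mono[of "UNIV :: 'a set" "{0, 1}"] by simp
  then have en: "e * n \<ge> 1" using n p by (cases e) auto
  note subfield = finite_subfield_frobenius_fixed_points[OF p(1) char en K_def]
  interpret finite_subfield K by (rule subfield)
  have cardK: "card K = CARD('a) ^ n"
    using card_frobenius_fixed_points[OF p(1) char en K_def] p(2) by (simp add: power_mult)
  have F: "range to_ac \<subseteq> K"
  proof
    fix x :: "'a alg_closure" assume "x \<in> range to_ac"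
    then obtain a where a: "x = to_ac a" by blast
    \<comment> \<open>Iterating \<open>a ^ CARD('a) = a\<close> shows that the base field is fixed
      by the power map that cuts out \<open>K\<close>.\<close>
    have "a ^ (CARD('a) ^ n) = a"
      by (induction n) (simp_all add: power_mult finite_subfield.power_card[OF finite_subfield_UNIV])
    then show "x \<in> K" by (simp add: K_def a power_mult flip: to_ac_power p(2))
  qed
  obtain R :: "'a alg_closure \<Rightarrow> 'a mat"
    where R: "\<And>x. R x \<in> carrier_mat n n"
      "\<And>x y. x \<in> K \<Longrightarrow> y \<in> K \<Longrightarrow> R (x + y) = R x + R y"
      "\<And>x y. x \<in> K \<Longrightarrow> y \<in> K \<Longrightarrow> R (x * y) = R x * R y"
      "\<And>a. R (to_ac a) = a \<cdot>\<^sub>m 1\<^sub>m n"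
    using regular_representation[OF subfield F cardK] by metis
  have R1: "R 1 = 1\<^sub>m n" using R(4)[of 1] by (auto intro: eq_matI)
  have Rpow: "R (x ^ j) = R x ^\<^sub>m j" if "x \<in> K" for x j
  proof (induction j)
    case 0
    then show ?case using R1 R(1)[of x] by simp
  next
    case (Suc j)
    then show ?case using R(3)[of "x ^ j" x] that by (simp add: mult.commute)
  qed
  obtain x y where xy: "x \<in> K" "y \<in> K" "to_ac l = x ^ k + y ^ k"
    using sum_of_two_powers[OF k, of "to_ac l"] large cardK F by (auto simp: image_subset_iff)
  have "l \<cdot>\<^sub>m 1\<^sub>m n = R x ^\<^sub>m k + R y ^\<^sub>m k"
    using R(4)[of l] R(2)[of "x ^ k" "y ^ k"] xy Rpow by simp
  then show ?thesis using R(1) by blast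
qed

section \<open>Long sums of powers\<close>

text \<open>Cauchy-Schwarz for the fibre sizes of \<open>f\<close>, whose squares add up to the
  number of colliding pairs.\<close>

lemma card_square_le_card_image_mult_collisions:
  assumes "finite S"
  shows "(card S)\<^sup>2 \<le> card (f ` S) * card {(s, t) \<in> S \<times> S. f s = f t}"
proof -
  let ?r = "\<lambda>y. card {s \<in> S. f s = y}"
  have S: "card S = (\<Sum>y\<in>f ` S. ?r y)"
    using sum.group[of S "f ` S" f "\<lambda>_. 1 :: nat"] assms by simp
  have "card {(s, t) \<in> S \<times> S. f s = f t} = card (\<Union>y\<in>f ` S. {s \<in> S. f s = y} \<times> {s \<in> S. f s = y})"
    by (rule arg_cong[of _ _ card]) auto
  also have "\<dots> = (\<Sum>y\<in>f ` S. ?r y * ?r y)"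
    using assms by (subst card_UN_disjoint) (auto simp: card_cartesian_product)
  finally have pairs: "card {(s, t) \<in> S \<times> S. f s = f t} = (\<Sum>y\<in>f ` S. (?r y)\<^sup>2)"
    by (simp add: power2_eq_square)
  have "(\<Sum>y\<in>f ` S. 1 * real (?r y))\<^sup>2 \<le> (\<Sum>y\<in>f ` S. 1\<^sup>2) * (\<Sum>y\<in>f ` S. (real (?r y))\<^sup>2)"
    by (rule Cauchy_Schwarz_ineq_sum)
  then have "real ((card S)\<^sup>2) \<le> real (card (f ` S) * card {(s, t) \<in> S \<times> S. f s = f t})"
    unfolding S pairs by simp
  then show ?thesis by (simp only: of_nat_le_iff)
qed

lemma card_filter_eq_sum: "finite A \<Longrightarrow> card {x \<in> A. Q x} = (\<Sum>x\<in>A. if Q x then 1 else 0)"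
  using sum.inter_filter[of A "\<lambda>_. 1 :: nat" Q] by simp

text \<open>Averaging over \<open>u\<close>, with \<open>M\<close> the number of pairs and
  \<open>q\<close> the size of the field. If every image had at most \<open>q / 2\<close> elements,
  each \<open>u\<close> would cause at least \<open>2 M^2 / q\<close> collisions. But two distinct
  pairs collide for at most one \<open>u\<close>, so the total is at most
  \<open>M (q + M - 1)\<close>, which is too small as \<open>M > q\<close>.\<close>

lemma exists_large_dilate_sumset:
  fixes D :: "'a::{field,finite} set"
  assumes large: "(card D)\<^sup>2 > CARD('a)"
  shows "\<exists>u. 2 * card ((\<lambda>(a, b). a + u * b) ` (D \<times> D)) > CARD('a)"
proof (rule ccontr)
  assume "\<not> ?thesis"
  then have small: "2 * card ((\<lambda>(a, b). a + u * b) ` (D \<times> D)) \<le> CARD('a)" for u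
    by (simp add: not_less)
  define f where "f u = (\<lambda>(a, b). a + u * b)" for u :: 'a
  define S where "S = D \<times> D"
  define M where "M = card S"
  define q where "q = CARD('a)"
  define E where "E u = card {(s, t) \<in> S \<times> S. f u s = f u t}" for u
  have M: "M > q" using large by (simp add: M_def S_def q_def power2_eq_square card_cartesian_product)
  have le: "2 * M\<^sup>2 \<le> q * E u" for u
  proof -
    have "2 * M\<^sup>2 \<le> 2 * card (f u ` S) * E u"
      using card_square_le_card_image_mult_collisions[of S "f u"] by (simp add: M_def E_def)
    also have "\<dots> \<le> q * E u"
      using small[of u] by (intro mult_right_mono) (auto simp: f_def S_def q_def)
    finally show ?thesis .
  qed
  have solutions: "card {u. f u s = f u t} \<le> (if s = t then q else 1)" for s t
  proof (cases "s = t")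
    case True
    then show ?thesis by (simp add: q_def)
  next
    case False
    have "u = v" if "f u s = f u t" "f v s = f v t" for u v
    proof -
      obtain a b c d where st: "s = (a, b)" "t = (c, d)" by fastforce
      have "a - c = u * (d - b)" "a - c = v * (d - b)"
        using that by (simp_all add: st f_def algebra_simps)
      then show ?thesis using False st by (cases "d = b") auto
    qed
    then have "{u. f u s = f u t} = {} \<or> (\<exists>u. {u. f u s = f u t} = {u})" by blast
    then show ?thesis using False by auto
  qed
  have "(\<Sum>u\<in>UNIV. E u) = (\<Sum>u\<in>UNIV. \<Sum>x\<in>S \<times> S. if f u (fst x) = f u (snd x) then 1 else 0)"
  proof (rule sum.cong)
    fix u
    have "{(s, t) \<in> S \<times> S. f u s = f u t} = {x \<in> S \<times> S. f u (fst x) = f u (snd x)}" by auto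
    then show "E u = (\<Sum>x\<in>S \<times> S. if f u (fst x) = f u (snd x) then 1 else 0)"
      by (simp add: E_def card_filter_eq_sum)
  qed simp
  also have "\<dots> = (\<Sum>x\<in>S \<times> S. card {u. f u (fst x) = f u (snd x)})"
    using card_filter_eq_sum[of "UNIV :: 'a set"] by (subst sum.swap) simp
  also have "\<dots> \<le> (\<Sum>x\<in>S \<times> S. if fst x = snd x then q else 1)"
    by (intro sum_mono solutions)
  also have "\<dots> = (\<Sum>s\<in>S. \<Sum>t\<in>S. if s = t then q else 1)"
    by (simp add: sum.cartesian_product')
  also have "\<dots> = (\<Sum>s\<in>S. q + (M - 1))"
  proof (rule sum.cong)
    fix s assume s: "s \<in> S"
    have "(\<Sum>t\<in>S. if s = t then q else 1) = q + (\<Sum>t\<in>S - {s}. if s = t then q else 1)"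
      using s by (simp add: sum.remove)
    also have "(\<Sum>t\<in>S - {s}. if s = t then q else 1) = (\<Sum>t\<in>S - {s}. 1)"
      by (intro sum.cong) auto
    finally show "(\<Sum>t\<in>S. if s = t then q else 1) = q + (M - 1)" using s by (simp add: M_def)
  qed simp
  finally have sum_E: "(\<Sum>u\<in>UNIV. E u) \<le> M * (q + (M - 1))" by (simp add: M_def)
  have q0: "q > 0" by (simp add: q_def)
  have "q * (2 * M\<^sup>2) = (\<Sum>u\<in>(UNIV :: 'a set). 2 * M\<^sup>2)" by (simp add: q_def)
  also have "\<dots> \<le> (\<Sum>u\<in>UNIV. q * E u)" by (intro sum_mono le)
  also have "\<dots> \<le> q * (M * (q + (M - 1)))"
    using sum_E by (simp add: sum_distrib_left[symmetric])
  finally have "2 * M\<^sup>2 \<le> M * (q + (M - 1))" using q0 by simp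
  then have "2 * M \<le> q + (M - 1)" using M q0 by (simp add: power2_eq_square)
  then show False using M by simp
qed

text \<open>The number of summands is exact and repetitions are allowed. Exactness matters because
  every diagonal entry of the two triangular summands must be a nonzero power.\<close>

definition sums_of :: "nat \<Rightarrow> 'a::comm_monoid_add set \<Rightarrow> 'a set" where
  "sums_of m P = {sum_list xs |xs. set xs \<subseteq> P \<and> length xs = m}"

lemma sums_of_0: "0 \<in> sums_of 0 P"
  by (simp add: sums_of_def)

lemma sums_of_singleton: "x \<in> P \<Longrightarrow> x \<in> sums_of 1 P"
  unfolding sums_of_def by (auto intro!: exI[of _ "[x]"])

lemma sums_of_add:
  assumes "x \<in> sums_of a P" "y \<in> sums_of b P"
  shows "x + y \<in> sums_of (a + b) P"
proof -
  obtain xs ys where "x = sum_list xs" "set xs \<subseteq> P" "length xs = a"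
    "y = sum_list ys" "set ys \<subseteq> P" "length ys = b"
    using assms by (auto simp: sums_of_def)
  then show ?thesis unfolding sums_of_def by (intro CollectI exI[of _ "xs @ ys"]) auto
qed

lemma sums_of_sum:
  assumes "finite I" "\<And>i. i \<in> I \<Longrightarrow> f i \<in> sums_of (a i) P"
  shows "(\<Sum>i\<in>I. f i) \<in> sums_of (\<Sum>i\<in>I. a i) P"
  using assms by (induction I rule: finite_induct) (auto intro: sums_of_0 sums_of_add)

lemma zero_sums_of_mult: "0 \<in> sums_of a P \<Longrightarrow> 0 \<in> sums_of (c * a) P"
  by (induction c) (auto intro: sums_of_0 dest: sums_of_add)

lemma sums_of_insert_zero:
  assumes "x \<in> sums_of m (insert 0 P)"
  shows "\<exists>j\<le>m. x \<in> sums_of j P"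
proof -
  obtain xs where "x = sum_list xs" "set xs \<subseteq> insert 0 P" "length xs = m"
    using assms by (auto simp: sums_of_def)
  moreover from this have "sum_list (filter (\<lambda>y. y \<noteq> 0) xs) = x"
    using sum_list_map_filter[of xs "\<lambda>y. y \<noteq> 0" "\<lambda>y. y"] by simp
  ultimately show ?thesis
    unfolding sums_of_def
    by (intro exI[of _ "length (filter (\<lambda>y. y \<noteq> 0) xs)"] conjI CollectI exI[of _ "filter (\<lambda>y. y \<noteq> 0) xs"]) auto
qed

lemma sums_of_uminus:
  fixes x :: "'a::ab_group_add"
  assumes P: "\<And>y. y \<in> P \<Longrightarrow> - y \<in> sums_of c P" and x: "x \<in> sums_of m P"
  shows "- x \<in> sums_of (m * c) P"
proof -
  have "- sum_list xs \<in> sums_of (length xs * c) P" if "set xs \<subseteq> P" for xs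
    using that
  proof (induction xs)
    case Nil
    then show ?case by (simp add: sums_of_0)
  next
    case (Cons y xs)
    then show ?case using sums_of_add[OF P[of y] Cons.IH] by simp
  qed
  then show ?thesis using x by (auto simp: sums_of_def)
qed

text \<open>
  As \<open>card D\<^sup>2 > q\<close>, every \<open>u\<close> is a quotient of differences of elements of \<open>D\<close>, so clearing
  denominators embeds a dilate of a large sumset \<open>D + u D\<close> into \<open>2D - 2D\<close>.
\<close>

lemma difference_of_four_sums:
  fixes D :: "'a::{field,finite} set"
  assumes mult: "\<And>x y. x \<in> D \<Longrightarrow> y \<in> D \<Longrightarrow> x * y \<in> D" and large: "(card D)\<^sup>2 > CARD('a)"
  shows "\<exists>x\<in>sums_of 4 D. \<exists>y\<in>sums_of 4 D. t = x - y"
proof -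
  obtain u where u: "2 * card ((\<lambda>(a, b). a + u * b) ` (D \<times> D)) > CARD('a)"
    using exists_large_dilate_sumset[OF large] by blast
  let ?f = "\<lambda>(a, b). a + u * b"
  \<comment> \<open>Pigeonhole: there are more pairs than field elements. The collision expresses
    \<open>u\<close> as \<open>(a - c) / (d - b)\<close>.\<close>
  have "\<not> inj_on ?f (D \<times> D)"
  proof
    assume "inj_on ?f (D \<times> D)"
    then have "card (D \<times> D) \<le> CARD('a)" by (intro card_inj_on_le) auto
    then show False using large by (simp add: card_cartesian_product power2_eq_square)
  qed
  then obtain a b c d where abcd: "a \<in> D" "b \<in> D" "c \<in> D" "d \<in> D" "a + u * b = c + u * d" "(a, b) \<noteq> (c, d)"
    by (auto simp: inj_on_def)
  have bd: "b \<noteq> d" using abcd by auto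
  have u_eq: "u * (d - b) = a - c" using abcd by (simp add: algebra_simps)
  define Z where "Z = (\<lambda>s. (d - b) * s) ` ?f ` (D \<times> D)"
  have two: "v + w \<in> sums_of 2 D" if "v \<in> D" "w \<in> D" for v w
    using sums_of_add[OF sums_of_singleton[OF that(1)] sums_of_singleton[OF that(2)]]
    by (simp add: numeral_2_eq_2)
  have Z: "\<exists>v\<in>sums_of 2 D. \<exists>w\<in>sums_of 2 D. s = v - w" if "s \<in> Z" for s
  proof -
    obtain x y where xy: "x \<in> D" "y \<in> D" "s = (d - b) * (x + u * y)" using \<open>s \<in> Z\<close> by (auto simp: Z_def)
    have "s = (d - b) * x + (u * (d - b)) * y" using xy by (simp add: algebra_simps)
    also have "\<dots> = (d * x + a * y) - (b * x + c * y)" unfolding u_eq by (simp add: algebra_simps)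
    finally show ?thesis using two mult abcd xy by blast
  qed
  have "card Z = card (?f ` (D \<times> D))"
    unfolding Z_def using bd by (intro card_image inj_onI) auto
  then have cardX: "2 * card Z > CARD('a)" using u by simp
  have "card ((\<lambda>s. t - s) ` Z) = card Z" by (intro card_image inj_onI) auto
  then have "Z \<inter> (\<lambda>s. t - s) ` Z \<noteq> {}"
    using cardX card_Un_disjoint[of Z "(\<lambda>s. t - s) ` Z"] card_mono[of UNIV "Z \<union> (\<lambda>s. t - s) ` Z"] by auto
  then obtain s s' where s: "s \<in> Z" "s' \<in> Z" "t = s + s'" by force
  obtain v w v' w' where vw: "v \<in> sums_of 2 D" "w \<in> sums_of 2 D" "v' \<in> sums_of 2 D" "w' \<in> sums_of 2 D"
    "s = v - w" "s' = v' - w'" using Z[OF s(1)] Z[OF s(2)] by blast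
  have "v + v' \<in> sums_of 4 D" "w + w' \<in> sums_of 4 D"
    using sums_of_add[OF vw(1,3)] sums_of_add[OF vw(2,4)] by simp_all
  moreover have "t = (v + v') - (w + w')" using s vw by simp
  ultimately show ?thesis by blast
qed

text \<open>Bezout writes the gcd as \<open>k * a\<close> minus a multiple of
  \<open>CARD('a) - 1\<close>, and exponents that are multiples of the latter act trivially on
  units. Hence \<open>y = x ^ a\<close> works.\<close>

lemma gcd_power_is_power:
  fixes x :: "'a::{field,finite}"
  assumes "x \<noteq> 0" "k \<ge> 1"
  shows "\<exists>y. y \<noteq> 0 \<and> x ^ gcd k (CARD('a) - 1) = y ^ k"
proof -
  obtain a b where ab: "k * a = (CARD('a) - 1) * b + gcd k (CARD('a) - 1)"
    using bezout_nat[of k "CARD('a) - 1"] assms by auto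
  have "(x ^ a) ^ k = x ^ (k * a)" by (simp add: power_mult[symmetric] mult.commute)
  also have "\<dots> = (x ^ (CARD('a) - 1)) ^ b * x ^ gcd k (CARD('a) - 1)"
    unfolding ab by (simp add: power_add power_mult)
  also have "x ^ (CARD('a) - 1) = 1"
    using finite_subfield.power_card_minus_one[OF finite_subfield_UNIV, of x] assms by simp
  finally show ?thesis using assms by (intro exI[of _ "x ^ a"]) simp
qed

text \<open>The \<open>d\<close>-th powers of units are \<open>k\<close>-th powers and number at
  least \<open>(q - 1) / d\<close>. Counting zero as well gives at least
  \<open>(q - 1 + d) / d\<close> elements; this extra element is what makes \<open>q > d^2\<close>
  sufficient.\<close>

lemma card_powers_square:
  assumes k: "k \<ge> 1" and d: "d = gcd k (CARD('a) - 1)" and large: "CARD('a::{field,finite}) > d\<^sup>2"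
  shows "(card (insert 0 ((\<lambda>x::'a. x ^ k) ` (UNIV - {0}))))\<^sup>2 > CARD('a)"
proof -
  let ?P = "(\<lambda>x::'a. x ^ k) ` (UNIV - {0})"
  let ?P' = "(\<lambda>x::'a. x ^ d) ` (UNIV - {0})"
  define h where "h = int (card ?P)"
  define q where "q = int CARD('a)"
  have d1: "d \<ge> 1" using k by (simp add: d Suc_le_eq)
  have "?P' \<subseteq> ?P" using gcd_power_is_power[OF _ k] by (fastforce simp: d)
  then have "card ?P' \<le> card ?P" by (intro card_mono) auto
  moreover have "card {x \<in> UNIV - {0}. x ^ d = a} \<le> d" for a :: 'a
    using card_mono[OF card_nth_roots_le(1)[OF d1, of a], of "{x \<in> UNIV - {0}. x ^ d = a}"]
      card_nth_roots_le(2)[OF d1, of a] by fastforce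
  then have "card (UNIV - {0 :: 'a}) \<le> d * card ?P'" by (intro card_le_mult_card_image) auto
  ultimately have "CARD('a) - 1 \<le> d * card ?P"
    by (simp add: card_Diff_singleton) (meson le_trans mult_le_mono2)
  then have "int (CARD('a) - 1) \<le> int (d * card ?P)" by (simp only: of_nat_le_iff)
  then have hd: "q - 1 \<le> int d * h" by (simp add: q_def h_def of_nat_diff)
  have qd: "q - 1 \<ge> (int d)\<^sup>2"
  proof -
    have "int (d\<^sup>2) < int CARD('a)" using large by (simp only: of_nat_less_iff)
    then show ?thesis unfolding q_def of_nat_power by linarith
  qed
  have "0 \<notin> ?P" using k by auto
  then have card: "card (insert 0 ?P) = Suc (card ?P)" by simp
  \<comment> \<open>The difference of the two sides factors as
    \<open>(q - 1) * (q - 1 + 2 * d - d^2)\<close>.\<close>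
  have "(int d)\<^sup>2 * q < (q - 1 + int d)\<^sup>2"
  proof -
    have "(int d)\<^sup>2 \<ge> 1" using d1 by (simp add: one_le_power)
    then have "(q - 1) * (q - 1 + 2 * int d - (int d)\<^sup>2) > 0"
      using qd d1 by (intro mult_pos_pos) linarith+
    then show ?thesis by (simp add: power2_eq_square algebra_simps)
  qed
  also have "\<dots> \<le> (int d * (h + 1))\<^sup>2"
  proof (rule power_mono)
    show "q - 1 + int d \<le> int d * (h + 1)" using hd by (simp add: algebra_simps)
    show "0 \<le> q - 1 + int d" using qd zero_le_power2[of "int d"] by linarith
  qed
  finally have "(int d)\<^sup>2 * q < (int d)\<^sup>2 * (h + 1)\<^sup>2" by (simp add: power_mult_distrib)
  then have "q < (h + 1)\<^sup>2" using d1 by simp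
  then have "int CARD('a) < int ((card (insert 0 ?P))\<^sup>2)" by (simp add: card q_def h_def add.commute)
  then show ?thesis by (simp only: of_nat_less_iff)
qed

text \<open>With \<open>CARD('a) - 1 = d * r * e\<close>, not all units are roots of
  \<open>X ^ (d * e) - 1\<close>, whose degree is too small. For a unit \<open>w\<close> that is
  not, \<open>w ^ (d * e)\<close> is a \<open>d\<close>-th power, hence a \<open>k\<close>-th power,
  and its \<open>r\<close>-th power is 1.\<close>

lemma exists_root_of_unity_power:
  assumes k: "k \<ge> 1" and r: "r \<ge> 2" "r dvd (CARD('a::{field,finite}) - 1) div gcd k (CARD('a) - 1)"
  shows "\<exists>y::'a. y \<noteq> 0 \<and> y ^ k \<noteq> 1 \<and> (y ^ k) ^ r = 1"
proof -
  define d where "d = gcd k (CARD('a) - 1)"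
  have "CARD('a) > 1"
    using card_mono[of "UNIV :: 'a set" "{0, 1}"] by simp
  obtain e where e: "(CARD('a) - 1) div d = r * e" using r(2) unfolding d_def by blast
  have q: "CARD('a) - 1 = d * (r * e)"
    using dvd_mult_div_cancel[of d "CARD('a) - 1"] by (simp add: d_def flip: e)
  have de: "d * e \<ge> 1" using q \<open>CARD('a) > 1\<close> by (cases "d * e") auto
  have "\<exists>w::'a. w \<noteq> 0 \<and> w ^ (d * e) \<noteq> 1"
  proof (rule ccontr)
    assume "\<not> ?thesis"
    then have "UNIV - {0 :: 'a} \<subseteq> {x. x ^ (d * e) = 1}" by auto
    then have "card (UNIV - {0 :: 'a}) \<le> d * e"
      using card_mono[OF card_nth_roots_le(1)[OF de]] card_nth_roots_le(2)[OF de] le_trans by blast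
    then have "d * (r * e) \<le> d * e" unfolding q[symmetric] by (simp add: card_Diff_singleton)
    then have "r * (d * e) \<le> 1 * (d * e)" by (simp add: mult_ac)
    then show False using r(1) de by (simp only: mult_le_cancel2) simp
  qed
  then obtain w :: 'a where w: "w \<noteq> 0" "w ^ (d * e) \<noteq> 1" by blast
  obtain y where y: "y \<noteq> 0" "(w ^ e) ^ d = y ^ k"
    using gcd_power_is_power[of "w ^ e" k] w k by (auto simp: d_def)
  have z: "y ^ k = w ^ (d * e)" using y(2) by (simp add: power_mult[symmetric] mult.commute)
  have "(y ^ k) ^ r = w ^ (CARD('a) - 1)" unfolding z q by (simp add: power_mult[symmetric] mult_ac)
  also have "\<dots> = 1"
    using finite_subfield.power_card_minus_one[OF finite_subfield_UNIV, of w] w by simp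
  finally show ?thesis using y(1) z w(2) by auto
qed

text \<open>Write \<open>t\<close> as a difference of two sums of at most four elements of
  \<open>P\<close>. Replacing each negative term by \<open>r - 1\<close> positive ones leaves at
  most \<open>4 + 4 * (r - 1) = 4 * r\<close> summands. The remaining places, at least
  \<open>(r - 1) * p\<close> of them, are filled with zero sums of lengths \<open>p\<close> and
  \<open>r\<close>.\<close>

lemma sums_of_all_long:
  fixes P :: "'a::{field,finite} set"
  assumes P: "\<And>x y. x \<in> P \<Longrightarrow> y \<in> P \<Longrightarrow> x * y \<in> P" "1 \<in> P"
    and large: "(card (insert 0 P))\<^sup>2 > CARD('a)"
    and z: "z \<in> P" "z \<noteq> 1" "z ^ r = 1" and r: "r \<ge> 1"
    and p: "of_nat p = (0 :: 'a)" "p mod r = 1" and m: "m \<ge> 4 * r + (r - 1) * p"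
  shows "t \<in> sums_of m P"
proof -
  have zpow: "z ^ i \<in> P" for i by (induction i) (auto intro: P z)
  have geo: "(\<Sum>i<r. z ^ i) = 0" using z geometric_sum[of z r] by simp
  have "(\<Sum>i<r. z ^ i) \<in> sums_of (\<Sum>i<r. 1) P"
    by (intro sums_of_sum sums_of_singleton zpow) auto
  then have zero_r: "0 \<in> sums_of r P" using geo by simp
  have "(\<Sum>i<p. 1) \<in> sums_of (\<Sum>i<p. 1) P"
    by (intro sums_of_sum sums_of_singleton P) auto
  then have zero_p: "0 \<in> sums_of p P" using p by simp
  have neg: "- x \<in> sums_of (r - 1) P" if "x \<in> P" for x
  proof -
    have "{..<r} = insert 0 {1..<r}" using r by auto
    then have "1 + (\<Sum>i\<in>{1..<r}. z ^ i) = 0" using geo by simp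
    then have "- x = (\<Sum>i\<in>{1..<r}. z ^ i * x)"
      unfolding sum_distrib_right[symmetric] by (simp add: add_eq_0_iff)
    also have "\<dots> \<in> sums_of (\<Sum>i\<in>{1..<r}. 1) P"
      by (intro sums_of_sum sums_of_singleton P zpow that) auto
    finally show ?thesis by simp
  qed
  have "x * y \<in> insert 0 P" if "x \<in> insert 0 P" "y \<in> insert 0 P" for x y using that P by auto
  then obtain x y where xy: "x \<in> sums_of 4 (insert 0 P)" "y \<in> sums_of 4 (insert 0 P)" "t = x - y"
    using difference_of_four_sums[OF _ large, of t] by blast
  obtain i j where ij: "i \<le> 4" "x \<in> sums_of i P" "j \<le> 4" "y \<in> sums_of j P"
    using sums_of_insert_zero xy by metis
  define c where "c = i + j * (r - 1)"
  have t: "t \<in> sums_of c P"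
    using sums_of_add[OF ij(2) sums_of_uminus[OF neg ij(4)]] xy(3) by (simp add: c_def)
  have "j * (r - 1) \<le> 4 * (r - 1)" using ij(3) by (rule mult_right_mono) simp
  then have "c \<le> 4 * r" using ij(1) r by (simp add: c_def algebra_simps)
  define b where "b = m - c"
  have mb: "m = c + b" "b \<ge> (r - 1) * p" using m \<open>c \<le> 4 * r\<close> by (auto simp: b_def)
  \<comment> \<open>Since \<open>p\<close> is 1 modulo \<open>r\<close>, using
    \<open>b mod r\<close> blocks of length \<open>p\<close> corrects the residue of
    \<open>b\<close>, and blocks of length \<open>r\<close> fill the rest.\<close>
  have "b mod r \<le> r - 1" using r by (simp add: less_Suc_eq_le[symmetric])
  then have le: "b mod r * p \<le> b" using mb(2) by (meson le_trans mult_le_mono1)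
  have "b mod r * p mod r = b mod r"
    using p(2) by (metis mod_mod_trivial mod_mult_right_eq mult.right_neutral)
  then have "r dvd b - b mod r * p" using le by (metis mod_eq_dvd_iff_nat)
  then obtain s where "b = b mod r * p + s * r" using le
    by (metis dvd_div_mult_self le_add_diff_inverse)
  then have "0 \<in> sums_of b P"
    using sums_of_add[OF zero_sums_of_mult[OF zero_p, of "b mod r"] zero_sums_of_mult[OF zero_r, of s]] by simp
  then show ?thesis using sums_of_add[OF t, of 0 b] mb(1) by simp
qed

section \<open>Distributing the summands over two diagonals, and the arithmetic of the size
  bound\<close>

lemma sums_of_double:
  assumes "t \<in> sums_of (2 * n) ((\<lambda>x. x ^ k) ` A)"
  obtains a b :: "nat \<Rightarrow> 'a::comm_semiring_1"
  where "\<And>i. i < n \<Longrightarrow> a i \<in> A" "\<And>i. i < n \<Longrightarrow> b i \<in> A" "t = (\<Sum>i<n. a i ^ k + b i ^ k)"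
proof -
  obtain xs where xs: "t = sum_list xs" "set xs \<subseteq> (\<lambda>x. x ^ k) ` A" "length xs = 2 * n"
    using assms by (auto simp: sums_of_def)
  have "\<exists>x. x \<in> A \<and> xs ! i = x ^ k" if "i < 2 * n" for i
    using xs(2,3) that nth_mem[of i xs] by fastforce
  then obtain c where c: "\<And>i. i < 2 * n \<Longrightarrow> c i \<in> A \<and> xs ! i = c i ^ k" by metis
  have split: "(\<Sum>i<n + m. g i) = (\<Sum>i<n. g i) + (\<Sum>i<m. g (n + i))" for g :: "nat \<Rightarrow> 'a" and m
    by (induction m) (auto simp: add.assoc)
  have "t = (\<Sum>i<n + n. c i ^ k)"
    unfolding xs(1) sum_list_sum_nth using xs(3) c by (intro sum.cong) auto
  also have "\<dots> = (\<Sum>i<n. c i ^ k + c (n + i) ^ k)" by (simp add: split sum.distrib)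
  finally show ?thesis using that[of c "\<lambda>i. c (n + i)"] c by simp
qed

text \<open>The number \<open>p - 1\<close> is even and at least 4, hence not prime. So a prime
  divisor \<open>r\<close> of it has cofactor at least 2.\<close>

lemma exists_proper_prime_divisor_pred:
  fixes p :: nat
  assumes "prime p" "p \<ge> 5" "gcd e (p - 1) \<ge> 2"
  obtains r where "prime r" "r dvd e" "p mod r = 1" "2 * r \<le> p - 1"
proof -
  obtain r where r: "prime r" "r dvd gcd e (p - 1)"
    using prime_factor_nat[of "gcd e (p - 1)"] assms(3) by auto
  then have "r dvd p - 1" by (meson dvd_trans gcd_dvd2)
  then obtain c where c: "p - 1 = r * c" by (rule dvdE)
  have "odd p" using assms prime_odd_nat by auto
  have "c \<noteq> 1"
  proof
    assume "c = 1"
    then have "prime (p - 1)" using c r by simp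
    moreover have "2 < p - 1" using assms(2) by linarith
    ultimately show False using \<open>odd p\<close> prime_odd_nat[of "p - 1"] by auto
  qed
  then have "c \<ge> 2" using c assms(2) by (cases c) auto
  then have "2 * r \<le> p - 1" unfolding c by (simp add: mult.commute)
  moreover have "p = 1 + r * c" using c assms(2) by simp
  then have "p mod r = 1" using prime_gt_1_nat[OF r(1)] mod_mult_self2[of 1 r c] by simp
  ultimately show ?thesis using that r by (meson dvd_trans gcd_dvd1)
qed

text \<open>Since \<open>2 * r \<le> p - 1\<close>, the left side is at most
  \<open>(p^2 + p - 4) / 2\<close>. Comparison with \<open>p^2 - 3 p + 10\<close> amounts to
  \<open>p^2 - 7 p + 24 \<ge> 0\<close>, a consequence of
  \<open>7 * p \<le> p * p + 13\<close>.\<close>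

lemma prime_bound_arith:
  fixes p r n :: nat
  assumes "2 * r \<le> p - 1" "r \<ge> 2" "2 * n + 3 * p \<ge> p * p + 10"
  shows "4 * r + (r - 1) * p \<le> 2 * n"
proof -
  obtain s where s: "r = Suc s" using assms(2) by (cases r) auto
  have p: "2 * s + 3 \<le> p" using assms(1,2) by (auto simp: s)
  have "2 * (s * p) + 3 * p \<le> p * p"
    using mult_right_mono[OF p, of p] by (simp add: algebra_simps)
  moreover have "7 * p \<le> p * p + 13"
  proof (cases "p \<ge> 7")
    case True
    then show ?thesis using mult_le_mono1[of 7 p p] by linarith
  next
    case False
    then have "p \<in> {0..6}" by auto
    then show ?thesis by (auto simp: numeral_eq_Suc atLeastAtMostSuc_conv)
  qed
  ultimately show ?thesis using p assms(3) by (simp add: s algebra_simps)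
qed

section \<open>Combining the scalar and the nonscalar case\<close>

theorem theorem1p16:
  fixes p l q n k d :: nat
  assumes "prime p" and "p \<ge> 5"
    and "q = p ^ l" and "CARD('a::{field,finite}) = q"
    and "n \<ge> 2" and "k \<ge> 1"
    and "d = gcd k (q - 1)"
    and "q > d\<^sup>2"
    and "\<not> p dvd k"
    and "gcd ((q - 1) div d) (p - 1) \<ge> 2"
    and "ereal (real n) >
      max (ereal (((real p)\<^sup>2 - 3 * real p + 9) / 2))
          (4 * ln_ext (real k - 1) / ereal (ln (real q)))"
  shows "\<forall>M \<in> carrier_mat n n. \<exists>A \<in> carrier_mat n n. \<exists>B \<in> carrier_mat n n.
    (M :: 'a mat) = A ^\<^sub>m k + B ^\<^sub>m k"
proof
  fix M :: "'a mat"
  assume M: "M \<in> carrier_mat n n"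
  note p = assms(1) and p5 = assms(2) and k = assms(6)
  have card: "CARD('a) = p ^ l" using assms(3,4) by simp
  have q1: "CARD('a) > 1"
    using card_mono[of "UNIV :: 'a set" "{0, 1}"] by simp
  have char: "CHAR('a) = p" using CHAR_finite_field[OF p card] .
  show "\<exists>A\<in>carrier_mat n n. \<exists>B\<in>carrier_mat n n. M = A ^\<^sub>m k + B ^\<^sub>m k"
  proof (cases "\<exists>c. M = c \<cdot>\<^sub>m 1\<^sub>m n")
    case True
    have "(k - 1) ^ 4 < CARD('a) ^ n"
    \<comment> \<open>For \<open>k = 1\<close> the left side is 0, and the claim needs no logarithm;
      otherwise \<open>ln_ext\<close> is the ordinary logarithm and the bound on \<open>n\<close> is
      exponentiated.\<close>
    proof (cases "k = 1")
      case True
      then show ?thesis using q1 by simp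
    next
      case False
      define m where "m = real k - 1"
      have m: "m > 0" "m = real (k - 1)" using k False by (auto simp: m_def of_nat_diff)
      have lnq: "ln (real q) > 0" using q1 assms(4) by simp
      have "4 * ln_ext m / ereal (ln (real q)) < ereal (real n)"
        using assms(11) by (simp add: m_def)
      then have "4 * ln m / ln (real q) < real n"
        using m lnq by (simp add: ln_ext_def numeral_eq_ereal)
      then have "ln (m ^ 4) < ln (real q ^ n)"
        using m lnq by (simp add: ln_realpow pos_divide_less_eq mult.commute)
      then have "m ^ 4 < real q ^ n" using m q1 assms(4) by simp
      then have "real ((k - 1) ^ 4) < real (CARD('a) ^ n)" using m assms(4) by simp
      then show ?thesis by (simp only: of_nat_less_iff)
    qed
    then show ?thesis
      using True scalar_mat_sum_of_two_powers[OF p card _ k] assms(5) by auto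
  next
    case False
    have k0: "of_nat k \<noteq> (0 :: 'a)"
      using assms(9) char of_nat_eq_0_iff_char_dvd[where 'a = 'a] by simp
    obtain r where r: "prime r" "r dvd (q - 1) div d" "p mod r = 1" "2 * r \<le> p - 1"
      using exists_proper_prime_divisor_pred[OF p p5 assms(10)] .
    have "(real p * real p - 3 * real p + 9) / 2 < real n"
      using assms(11) by (simp add: power2_eq_square)
    then have "real (p * p + 9) < real (2 * n + 3 * p)" by simp
    \<comment> \<open>Integrality sharpens the strict inequality by one.\<close>
    then have "2 * n + 3 * p \<ge> p * p + 10" by linarith
    then have long: "4 * r + (r - 1) * p \<le> 2 * n"
      using prime_bound_arith r(4) prime_ge_2_nat[OF r(1)] by blast
    define P where "P = (\<lambda>x::'a. x ^ k) ` (UNIV - {0})"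
    obtain y :: 'a where y: "y \<noteq> 0" "y ^ k \<noteq> 1" "(y ^ k) ^ r = 1"
      using exists_root_of_unity_power[OF k prime_ge_2_nat[OF r(1)]] r(2) assms(4,7) by auto
    \<comment> \<open>The trace is the only constraint on a prescribed diagonal, so it is split into
      exactly \<open>2 * n\<close> nonzero powers, \<open>n\<close> for each triangular
      summand.\<close>
    have "(\<Sum>i<n. M $$ (i, i)) \<in> sums_of (2 * n) P"
    proof (rule sums_of_all_long[where z = "y ^ k" and r = r and p = p])
      show "u * v \<in> P" if "u \<in> P" "v \<in> P" for u v
        using that by (auto simp: P_def power_mult_distrib[symmetric])
      show "1 \<in> P" unfolding P_def by (intro image_eqI[of _ _ 1]) auto
      show "(card (insert 0 P))\<^sup>2 > CARD('a)"
        unfolding P_def using card_powers_square[OF k, where 'a = 'a and d = d] assms(4,7,8) by simp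
      show "of_nat p = (0 :: 'a)" using char of_nat_CHAR by metis
    qed (use y r long prime_ge_1_nat in \<open>auto simp: P_def\<close>)
    then obtain a b where "\<And>i. i < n \<Longrightarrow> a i \<in> UNIV - {0}" "\<And>i. i < n \<Longrightarrow> b i \<in> UNIV - {0}"
      "(\<Sum>i<n. M $$ (i, i)) = (\<Sum>i<n. a i ^ k + b i ^ k)"
      unfolding P_def by (rule sums_of_double) blast
    then show ?thesis
      using nonscalar_mat_sum_of_two_powers[OF M _ k0, of a b] False by auto
  qed
qed

end
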